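(* Let $\mathbf{B}\subset\mathbb{R}^n$ be a compact box, let $\mu$ be a finite Borel measure on $\mathbb{R}^n$ whose support is $\mathbf{B}$, with moments $z_\alpha=\int\mathbf{x}^\alpha\,d\mu(\mathbf{x})$, $\alpha\in\mathbb{N}^n$, and write $\mathbf{z}=(z_\alpha)_{\alpha\in\mathbb{N}^n}$. For $i=1,\ldots,p$ let $\mathbf{\Omega}_i=\{\mathbf{x}\in\mathbb{R}^n : g_{ij}(\mathbf{x})\ge 0,\ j=1,\ldots,m_i\}$ with $g_{ij}\in\mathbb{R}[\mathbf{x}]$, such that $\mathbf{\Omega}:=\bigcup_{i=1}^p\mathbf{\Omega}_i\subset\mathbf{B}$. Let $f\in\mathbb{R}[\mathbf{x}]$ be positive $\mu$-almost everywhere on $\mathbf{\Omega}$. Put $r_{ij}=\lceil\deg(g_{ij})/2\rceil$, $r_{00}=\lceil\deg(f)/2\rceil$, and let $d_0$ be the maximum of $r_{00}$ and all the $r_{ij}$. For every integer $d\ge d_0$ consider the semidefinite program $$\mathbf{Q}_d:\quad \rho_d^f=\sup_{\mathbf{y}^1,\ldots,\mathbf{y}^p}\Big\{\sum_{i=1}^pL_{\mathbf{y}^i}(f)\ :\ \mathbf{M}_d\Big(\mathbf{z}-\sum_{i=1}^p\mathbf{y}^i\Big)\succeq0;\ \mathbf{M}_d(\mathbf{y}^i)\succeq0,\ i=1,\ldots,p;\ \mathbf{M}_{d-r_{ij}}(g_{ij}\,\mathbf{y}^i)\succeq0,\ j=1,\ldots,m_i,\ i=1,\ldots,p\Big\},$$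 where each $\mathbf{y}^i=(y^i_\alpha)_{\alpha\in\mathbb{N}^n_{2d}}$ is a real sequence. Let $$f^*=\sup_{\phi_1,\ldots,\phi_p}\Big\{\sum_{i=1}^p\int_{\mathbf{\Omega}_i}f\,d\phi_i\ :\ \sum_{i=1}^p\phi_i\le\mu;\ \phi_i\in\mathcal{M}(\mathbf{\Omega}_i)_+,\ i=1,\ldots,p\Big\}.$$ Then: (i) For every $d\ge d_0$, $\mathbf{Q}_d$ has an optimal solution, and the sequence of optimal values $(\rho_d^f)_{d\ge d_0}$ is monotone nonincreasing and converges to $f^*$, that is, $\rho_d^f\downarrow f^*=\int_{\mathbf{\Omega}}f\,d\mu$ as $d\to\infty$. (ii) For each $d\ge d_0$ let $(\mathbf{y}^{1,d},\ldots,\mathbf{y}^{p,d})$ be an optimal solution of $\mathbf{Q}_d$. Then for each $\alpha\in\mathbb{N}^n$, $$\lim_{d\to\infty}\sum_{i=1}^p y_\alpha^{i,d}=\int_{\mathbf{\Omega}}\mathbf{x}^\alpha\,d\mu,$$ and in particular $\lim_{d\to\infty}\sum_{i=1}^p y_0^{i,d}=\mu(\mathbf{\Omega})$.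
   Context: A box is a product of $n$ compact intervals of positive length. $\mathbb{N}$ includes $0$; $\mathbb{N}^n_d=\{\gamma\in\mathbb{N}^n:|\gamma|\le d\}$ with $|\gamma|=\sum_i\gamma_i$. For a real sequence $\mathbf{y}=(y_\gamma)$ indexed by $\mathbb{N}^n_{2d}$ (or by $\mathbb{N}^n$), the Riesz functional is $L_{\mathbf{y}}(h)=\sum_\gamma h_\gamma y_\gamma$ for $h=\sum_\gamma h_\gamma\mathbf{x}^\gamma$ (of degree at most $2d$ in the former case). The moment matrix $\mathbf{M}_d(\mathbf{y})$ is the real symmetric matrix with rows and columns indexed by $\mathbb{N}^n_d$ and entries $\mathbf{M}_d(\mathbf{y})(\alpha,\beta)=y_{\alpha+\beta}$. For $g=\sum_\gamma g_\gamma\mathbf{x}^\gamma\in\mathbb{R}[\mathbf{x}]$, the localizing matrix $\mathbf{M}_d(g\,\mathbf{y})$ is indexed by $\mathbb{N}^n_d$ and has entries $\mathbf{M}_d(g\,\mathbf{y})(\alpha,\beta)=L_{\mathbf{y}}(g\,\mathbf{x}^{\alpha+\beta})=\sum_\gamma g_\gamma y_{\alpha+\beta+\gamma}$. $\mathbf{A}\succeq0$ means that $\mathbf{A}$ is positive semidefinite. In $\mathbf{z}-\sum_i\mathbf{y}^i$ the sequence $\mathbf{z}$ is truncated to indices in $\mathbb{N}^n_{2d}$. For a Borel set $C$, $\mathcal{M}(C)_+$ is the cone of finite (nonnegative) Borel measures on $C$, regarded as measures on $\mathbb{R}^n$ giving zero mass to the complement of $C$; $\nu\le\mu$ means $\nu(C)\le\mu(C)$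 for all Borel $C$. *)

theory Defs
  imports "HOL-Analysis.Analysis" "HOL-Library.Poly_Mapping"
begin

text \<open>
  Exponents are vectors of type \<open>nat ^ 'n\<close>, with \<open>n = CARD('n)\<close>, and the polynomial ring
  in \<open>n\<close> variables is the monoid algebra of \<open>nat ^ 'n\<close> over the reals.
\<close>

type_synonym 'n poly_ring = "(nat ^ 'n) \<Rightarrow>\<^sub>0 real"

definition size_exp :: "nat ^ 'n \<Rightarrow> nat" where
  "size_exp \<gamma> = (\<Sum>i\<in>UNIV. \<gamma> $ i)"

definition exps_upto :: "nat \<Rightarrow> (nat ^ 'n) set" where
  "exps_upto d = {\<gamma>. size_exp \<gamma> \<le> d}"

definition monom_at :: "nat ^ 'n \<Rightarrow> real ^ 'n \<Rightarrow> real" where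
  "monom_at \<gamma> x = (\<Prod>i\<in>UNIV. (x $ i) ^ (\<gamma> $ i))"

definition poly_at :: "('n::finite) poly_ring \<Rightarrow> real ^ 'n \<Rightarrow> real" where
  "poly_at h x = (\<Sum>\<gamma>\<in>Poly_Mapping.keys h. Poly_Mapping.lookup h \<gamma> * monom_at \<gamma> x)"

text \<open>The total degree; the zero polynomial has degree \<open>0\<close>.\<close>

definition total_deg :: "('n::finite) poly_ring \<Rightarrow> nat" where
  "total_deg h = Max (insert 0 (size_exp ` Poly_Mapping.keys h))"

definition half_deg :: "('n::finite) poly_ring \<Rightarrow> nat" where
  "half_deg h = nat \<lceil>real (total_deg h) / 2\<rceil>"

definition riesz :: "(nat ^ 'n \<Rightarrow> real) \<Rightarrow> 'n poly_ring \<Rightarrow> real" where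
  "riesz y h = (\<Sum>\<gamma>\<in>Poly_Mapping.keys h. Poly_Mapping.lookup h \<gamma> * y \<gamma>)"

text \<open>
  Matrices with rows and columns indexed by a finite set \<open>I\<close> are binary functions of
  which only the values on \<open>I\<close> matter.
\<close>

definition psd_on :: "'a set \<Rightarrow> ('a \<Rightarrow> 'a \<Rightarrow> real) \<Rightarrow> bool" where
  "psd_on I A \<longleftrightarrow>
     (\<forall>a\<in>I. \<forall>b\<in>I. A a b = A b a) \<and>
     (\<forall>v. 0 \<le> (\<Sum>a\<in>I. \<Sum>b\<in>I. v a * A a b * v b))"

definition moment_matrix :: "(nat ^ 'n \<Rightarrow> real) \<Rightarrow> nat ^ 'n \<Rightarrow> nat ^ 'n \<Rightarrow> real" where
  "moment_matrix y \<alpha> \<beta> = y (\<alpha> + \<beta>)"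

definition localizing_matrix ::
    "('n::finite) poly_ring \<Rightarrow> (nat ^ 'n \<Rightarrow> real) \<Rightarrow> nat ^ 'n \<Rightarrow> nat ^ 'n \<Rightarrow> real" where
  "localizing_matrix g y \<alpha> \<beta> = riesz y (g * Poly_Mapping.single (\<alpha> + \<beta>) 1)"

definition compact_box :: "(real ^ 'n) set \<Rightarrow> bool" where
  "compact_box B \<longleftrightarrow> (\<exists>a b. (\<forall>i. a $ i < b $ i) \<and> B = cbox a b)"

definition measure_support :: "'a::topological_space measure \<Rightarrow> 'a set" where
  "measure_support M = {x. \<forall>U. open U \<and> x \<in> U \<longrightarrow> emeasure M U > 0}"

definition moments :: "(real ^ 'n) measure \<Rightarrow> nat ^ 'n \<Rightarrow> real" where
  "moments M \<alpha> = (LINT x|M. monom_at \<alpha> x)"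

text \<open>
  Intended for Borel sets \<open>C\<close> only, since \<open>emeasure\<close> is \<open>0\<close> on non-measurable sets.
\<close>

definition finite_borel_measures_on :: "'a::topological_space set \<Rightarrow> 'a measure set" where
  "finite_borel_measures_on C =
     {M. sets M = sets borel \<and> finite_measure M \<and> emeasure M (- C) = 0}"

definition semialg :: "nat \<Rightarrow> (nat \<Rightarrow> ('n::finite) poly_ring) \<Rightarrow> (real ^ 'n) set" where
  "semialg k h = {x. \<forall>j\<in>{1..k}. poly_at (h j) x \<ge> 0}"

definition min_order ::
    "nat \<Rightarrow> (nat \<Rightarrow> nat) \<Rightarrow> (nat \<Rightarrow> nat \<Rightarrow> ('n::finite) poly_ring) \<Rightarrow> 'n poly_ring \<Rightarrow> nat" where
  "min_order p m g f =
     Max (insert (half_deg f) {half_deg (g i j) |i j. i \<in> {1..p} \<and> j \<in> {1..m i}})"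

text \<open>
  Sequences indexed by the exponents of size at most \<open>2 * d\<close> are represented by total
  functions. When \<open>d\<close> is at least \<open>min_order p m g f\<close>, feasibility and objective value
  depend only on the values at exponents of size at most \<open>2 * d\<close>; in particular the
  sequence \<open>z\<close> is implicitly truncated there.
\<close>

definition sdp_feasible ::
    "nat \<Rightarrow> (nat \<Rightarrow> nat) \<Rightarrow> (nat \<Rightarrow> nat \<Rightarrow> ('n::finite) poly_ring) \<Rightarrow> (nat ^ 'n \<Rightarrow> real) \<Rightarrow> nat
      \<Rightarrow> (nat \<Rightarrow> nat ^ 'n \<Rightarrow> real) set" where
  "sdp_feasible p m g z d =
     {y. psd_on (exps_upto d) (moment_matrix (\<lambda>\<alpha>. z \<alpha> - (\<Sum>i=1..p. y i \<alpha>))) \<and>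
         (\<forall>i\<in>{1..p}. psd_on (exps_upto d) (moment_matrix (y i))) \<and>
         (\<forall>i\<in>{1..p}. \<forall>j\<in>{1..m i}.
            psd_on (exps_upto (d - half_deg (g i j))) (localizing_matrix (g i j) (y i)))}"

definition sdp_objective :: "nat \<Rightarrow> ('n::finite) poly_ring \<Rightarrow> (nat \<Rightarrow> nat ^ 'n \<Rightarrow> real) \<Rightarrow> real" where
  "sdp_objective p f y = (\<Sum>i=1..p. riesz (y i) f)"

text \<open>
  Suprema are taken in the extended reals, so that they are meaningful before boundedness
  and feasibility have been established.
\<close>

definition sdp_value ::
    "nat \<Rightarrow> (nat \<Rightarrow> nat) \<Rightarrow> (nat \<Rightarrow> nat \<Rightarrow> ('n::finite) poly_ring) \<Rightarrow> (nat ^ 'n \<Rightarrow> real) \<Rightarrow> 'n poly_ring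
      \<Rightarrow> nat \<Rightarrow> ereal" where
  "sdp_value p m g z f d = (SUP y\<in>sdp_feasible p m g z d. ereal (sdp_objective p f y))"

definition sdp_optimal ::
    "nat \<Rightarrow> (nat \<Rightarrow> nat) \<Rightarrow> (nat \<Rightarrow> nat \<Rightarrow> ('n::finite) poly_ring) \<Rightarrow> (nat ^ 'n \<Rightarrow> real) \<Rightarrow> 'n poly_ring
      \<Rightarrow> nat \<Rightarrow> (nat \<Rightarrow> nat ^ 'n \<Rightarrow> real) \<Rightarrow> bool" where
  "sdp_optimal p m g z f d y \<longleftrightarrow>
     y \<in> sdp_feasible p m g z d \<and>
     (\<forall>y'\<in>sdp_feasible p m g z d. sdp_objective p f y' \<le> sdp_objective p f y)"

definition measure_lp_feasible ::
    "nat \<Rightarrow> (nat \<Rightarrow> (real ^ 'n) set) \<Rightarrow> (real ^ 'n) measure \<Rightarrow> (nat \<Rightarrow> (real ^ 'n) measure) set" where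
  "measure_lp_feasible p W \<mu> =
     {\<phi>. (\<forall>C\<in>sets borel. (\<Sum>i=1..p. emeasure (\<phi> i) C) \<le> emeasure \<mu> C) \<and>
         (\<forall>i\<in>{1..p}. \<phi> i \<in> finite_borel_measures_on (W i))}"

definition measure_lp_value ::
    "nat \<Rightarrow> (nat \<Rightarrow> (real ^ 'n) set) \<Rightarrow> (real ^ 'n) measure \<Rightarrow> 'n poly_ring \<Rightarrow> ereal" where
  "measure_lp_value p W \<mu> f =
     (SUP \<phi>\<in>measure_lp_feasible p W \<mu>. ereal (\<Sum>i=1..p. LINT x:W i|\<phi> i. poly_at f x))"

end

theory Submission
  imports Defs "HOL-Complex_Analysis.Great_Picard"
begin

text \<open>Write \<open>L\<^sub>i\<close> for the Riesz functional of \<open>y\<^sup>i\<close>. The proof rests on a weak compactness argument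
  followed by an identification of all possible limits.

  \<^bold>\<open>Compactness.\<close> Feasibility bounds the diagonal entries \<open>y\<^sup>i(\<gamma> + \<gamma>)\<close> by \<open>z(\<gamma> + \<gamma>)\<close>, hence
  each coordinate by a constant that does not depend on \<open>d\<close> once \<open>d \<ge> |\<gamma>|\<close>. A maximizing
  sequence for a fixed \<open>d\<close> therefore has a pointwise limit, which is an optimal solution
  (\<open>sdp_optimal_exists\<close>), and a sequence of optimal solutions, one for each \<open>d\<close>, has
  subsequences converging pointwise to sequences \<open>Y\<^sup>i\<close> feasible for every \<open>d\<close>.

  \<^bold>\<open>Limits.\<close> For such \<open>Y\<^sup>i\<close> one has \<open>L\<^sub>i(h\<^sup>2) \<ge> 0\<close>, \<open>L\<^sub>i(g\<^sub>i\<^sub>j h\<^sup>2) \<ge> 0\<close> and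
  \<open>\<Sum>\<^sub>i L\<^sub>i(h\<^sup>2) \<le> \<integral> h\<^sup>2 d\<mu>\<close> for all polynomials \<open>h\<close>. Since \<open>\<mu>\<close> lives on a compact set \<open>B\<close>, the last
  condition makes \<open>L\<^sub>i\<close> bounded in the uniform norm on \<open>B\<close>. By the Stone-Weierstrass theorem
  \<open>L\<^sub>i\<close> extends to continuous functions, and since squares of polynomials approximate every
  nonnegative continuous function, the three inequalities pass from squares to all
  nonnegative continuous functions. Let \<open>T = \<Sum>\<^sub>i L\<^sub>i\<close>, so that \<open>0 \<le> T u \<le> \<integral> u d\<mu>\<close> for \<open>u \<ge> 0\<close>.
  One principle is then used twice (\<open>positive_functional_vanishing\<close>): if \<open>T v = 0\<close> for a
  continuous \<open>v \<ge> 0\<close>, then \<open>T\<close> ignores the set where \<open>v > 0\<close>, because \<open>T (min u (n v)) \<le> n T v = 0\<close>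
  and \<open>u - min u (n v)\<close> decreases to the restriction of \<open>u\<close> to \<open>{v = 0}\<close>.

  \<^item> The localizing constraints force \<open>T V = 0\<close> for a continuous \<open>V \<ge> 0\<close> whose zero set is
    \<open>\<Omega>\<close>. Hence \<open>T u \<le> \<integral>\<^sub>\<Omega> u d\<mu>\<close> for \<open>u \<ge> 0\<close>, and in particular \<open>T f \<le> \<integral>\<^sub>\<Omega> f d\<mu>\<close>.
  \<^item> If \<open>T f = \<integral>\<^sub>\<Omega> f d\<mu>\<close>, apply the principle to the positive functional \<open>u \<mapsto> \<integral>\<^sub>\<Omega> u d\<mu> - T u\<close> and
    to the positive part of \<open>f\<close>, which is positive almost everywhere on \<open>\<Omega>\<close>: the
    functional vanishes, so \<open>T u = \<integral>\<^sub>\<Omega> u d\<mu>\<close> for every \<open>u\<close>.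

  \<^bold>\<open>Conclusion.\<close> Cut \<open>\<Omega>\<close> into disjoint pieces \<open>D\<^sub>i \<subseteq> \<Omega>\<^sub>i\<close>. The moments of \<open>\<mu>\<close> on the \<open>D\<^sub>i\<close> are
  feasible for every \<open>d\<close> with value \<open>\<integral>\<^sub>\<Omega> f d\<mu>\<close>. Optimal solutions thus have at least this
  value, so every limit is in the equality case, and all subsequential limits of
  \<open>\<Sum>\<^sub>i y\<^sup>i(\<alpha>)\<close> equal \<open>\<integral>\<^sub>\<Omega> x\<^sup>\<alpha> d\<mu>\<close>. The same pieces solve the linear program on measures.\<close>

section \<open>Polynomials and Riesz functionals\<close>

lemma riesz_superset:
  assumes "finite A" "Poly_Mapping.keys h \<subseteq> A"
  shows "riesz y h = (\<Sum>\<gamma>\<in>A. Poly_Mapping.lookup h \<gamma> * y \<gamma>)"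
  unfolding riesz_def
  by (rule sum.mono_neutral_left) (use assms in \<open>auto simp: in_keys_iff\<close>)

lemma riesz_0 [simp]: "riesz y 0 = 0"
  by (simp add: riesz_def)

lemma riesz_single [simp]: "riesz y (Poly_Mapping.single a c) = c * y a"
  by (simp add: riesz_def)

lemma riesz_1 [simp]: "riesz y 1 = y 0"
  using riesz_single[of y 0 1] by simp

lemma riesz_add: "riesz y (h + k) = riesz y h + riesz y k"
proof -
  let ?A = "Poly_Mapping.keys h \<union> Poly_Mapping.keys k"
  have "Poly_Mapping.keys (h + k) \<subseteq> ?A" by (rule keys_add)
  then show ?thesis
    using riesz_superset[of ?A h y] riesz_superset[of ?A k y] riesz_superset[of ?A "h+k" y]
    by (simp add: lookup_add sum.distrib distrib_right)
qed

lemma riesz_uminus: "riesz y (- h) = - riesz y h"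
  using riesz_add[of y h "- h"] by simp

lemma riesz_diff: "riesz y (h - k) = riesz y h - riesz y k"
  using riesz_add[of y h "- k"] by (simp add: riesz_uminus)

lemma riesz_sum: "riesz y (sum h I) = (\<Sum>i\<in>I. riesz y (h i))"
  by (induction I rule: infinite_finite_induct) (auto simp: riesz_add)

lemma riesz_diff_seq: "riesz (\<lambda>\<alpha>. y \<alpha> - y' \<alpha>) h = riesz y h - riesz y' h"
  by (simp add: riesz_def right_diff_distrib sum_subtractf)

lemma riesz_sum_seq: "riesz (\<lambda>\<alpha>. \<Sum>i\<in>I. y i \<alpha>) h = (\<Sum>i\<in>I. riesz (y i) h)"
  unfolding riesz_def sum_distrib_left by (rule sum.swap)

lemma sum_monomials:
  assumes "finite A" "Poly_Mapping.keys h \<subseteq> A"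
  shows "(\<Sum>a\<in>A. Poly_Mapping.single a (Poly_Mapping.lookup h a)) = h"
proof (rule poly_mapping_eqI)
  fix k
  have "(\<Sum>a\<in>A. Poly_Mapping.lookup h a when a = k) = Poly_Mapping.lookup h k"
  proof (cases "k \<in> A")
    case True
    then show ?thesis using assms(1)
      by (simp add: when_def sum.delta)
  next
    case False
    then have "Poly_Mapping.lookup h k = 0" using assms(2) by (auto simp: in_keys_iff)
    with False show ?thesis by (auto simp: when_def intro!: sum.neutral)
  qed
  then show "Poly_Mapping.lookup (\<Sum>a\<in>A. Poly_Mapping.single a (Poly_Mapping.lookup h a)) k
      = Poly_Mapping.lookup h k"
    by (simp add: lookup_sum lookup_single)
qed

text \<open>Both the multiplicativity of evaluation and the link between quadratic forms of moment
  matrices and the values \<open>riesz y (h * h)\<close> are instances of this expansion.\<close>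

lemma riesz_mult_expand:
  assumes "finite A" "Poly_Mapping.keys h \<subseteq> A" "finite A'" "Poly_Mapping.keys k \<subseteq> A'"
  shows "riesz y (h * k) =
    (\<Sum>a\<in>A. \<Sum>b\<in>A'. Poly_Mapping.lookup h a * y (a + b) * Poly_Mapping.lookup k b)"
proof -
  have "h * k = (\<Sum>a\<in>A. Poly_Mapping.single a (Poly_Mapping.lookup h a))
      * (\<Sum>b\<in>A'. Poly_Mapping.single b (Poly_Mapping.lookup k b))"
    using assms by (simp add: sum_monomials)
  also have "\<dots> = (\<Sum>a\<in>A. \<Sum>b\<in>A'.
      Poly_Mapping.single (a + b) (Poly_Mapping.lookup h a * Poly_Mapping.lookup k b))"
    by (simp add: sum_product mult_single)
  finally show ?thesis
    by (simp add: riesz_sum mult_ac)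
qed

lemma riesz_const_mult: "riesz y (Poly_Mapping.single 0 c * h) = c * riesz y h"
proof -
  have "riesz y (Poly_Mapping.single 0 c * h) = (\<Sum>a\<in>{0}. \<Sum>b\<in>Poly_Mapping.keys h.
      Poly_Mapping.lookup (Poly_Mapping.single 0 c) a * y (a + b) * Poly_Mapping.lookup h b)"
    by (rule riesz_mult_expand) auto
  then show ?thesis by (simp add: riesz_def sum_distrib_left mult_ac)
qed

text \<open>Localizing by \<open>g\<close> is itself a change of sequence: the localizing matrix of \<open>y\<close> is the
  moment matrix of \<open>localized g y\<close>, so both kinds of semidefinite constraint are treated
  by the same lemmas.\<close>

definition localized :: "('n::finite) poly_ring \<Rightarrow> (nat ^ 'n \<Rightarrow> real) \<Rightarrow> nat ^ 'n \<Rightarrow> real" where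
  "localized g y \<gamma> = riesz y (g * Poly_Mapping.single \<gamma> 1)"

lemma localizing_matrix_localized: "localizing_matrix g y = moment_matrix (localized g y)"
  by (intro ext) (simp add: localizing_matrix_def moment_matrix_def localized_def)

lemma riesz_localized: "riesz (localized g y) h = riesz y (g * h)"
proof -
  have "g * h = g * (\<Sum>a\<in>Poly_Mapping.keys h. Poly_Mapping.single a (Poly_Mapping.lookup h a))"
    by (simp add: sum_monomials)
  also have "\<dots> = (\<Sum>a\<in>Poly_Mapping.keys h.
      Poly_Mapping.single 0 (Poly_Mapping.lookup h a) * (g * Poly_Mapping.single a 1))"
    unfolding sum_distrib_left
    by (rule sum.cong) (simp_all add: mult.left_commute[of _ g] mult_single)
  finally show ?thesis
    unfolding riesz_def[of "localized g y"]
    by (simp only: riesz_sum riesz_const_mult localized_def)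
qed

lemma monom_at_0 [simp]: "monom_at 0 x = 1"
  by (simp add: monom_at_def)

lemma monom_at_add: "monom_at (a + b) x = monom_at a x * monom_at b x"
  by (simp add: monom_at_def power_add prod.distrib)

text \<open>Evaluation at a point is the Riesz functional of the moments of a Dirac measure, so it
  inherits linearity.\<close>

lemma poly_at_riesz: "poly_at h x = riesz (\<lambda>\<gamma>. monom_at \<gamma> x) h"
  by (simp add: poly_at_def riesz_def)

lemma poly_at_simps [simp]:
  "poly_at 0 x = 0"
  "poly_at 1 x = 1"
  "poly_at (Poly_Mapping.single a c) x = c * monom_at a x"
  "poly_at (h + k) x = poly_at h x + poly_at k x"
  "poly_at (h - k) x = poly_at h x - poly_at k x"
  by (simp_all add: poly_at_riesz riesz_add riesz_diff)

lemma poly_at_mult [simp]: "poly_at (h * k) x = poly_at h x * poly_at k x"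
proof -
  have "poly_at (h * k) x = (\<Sum>a\<in>Poly_Mapping.keys h. \<Sum>b\<in>Poly_Mapping.keys k.
      Poly_Mapping.lookup h a * monom_at (a + b) x * Poly_Mapping.lookup k b)"
    unfolding poly_at_riesz by (rule riesz_mult_expand) auto
  also have "\<dots> = poly_at h x * poly_at k x"
    unfolding poly_at_def sum_product by (simp add: monom_at_add mult_ac)
  finally show ?thesis .
qed

lemma continuous_monom_at [continuous_intros]: "continuous_on S (monom_at \<gamma>)"
  unfolding monom_at_def[abs_def] by (intro continuous_intros)

lemma continuous_poly_at [continuous_intros]: "continuous_on S (poly_at h)"
  unfolding poly_at_def[abs_def] by (intro continuous_intros)

lemma component_le_size_exp: "\<gamma> $ i \<le> size_exp \<gamma>"
  unfolding size_exp_def by (rule member_le_sum) auto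

lemma size_exp_add: "size_exp (a + b) = size_exp a + size_exp b"
  by (simp add: size_exp_def sum.distrib)

lemma size_exp_0 [simp]: "size_exp 0 = 0"
  by (simp add: size_exp_def)

lemma finite_exps_upto: "finite (exps_upto d :: (nat ^ 'n::finite) set)"
proof (rule finite_subset)
  show "(exps_upto d :: (nat ^ 'n) set) \<subseteq> vec_lambda ` (PiE UNIV (\<lambda>_. {..d}))"
  proof
    fix \<gamma> :: "nat ^ 'n" assume "\<gamma> \<in> exps_upto d"
    then have "\<gamma> $ i \<le> d" for i
      using component_le_size_exp[of \<gamma> i] by (simp add: exps_upto_def)
    then have "vec_nth \<gamma> \<in> PiE UNIV (\<lambda>_. {..d})" by auto
    then show "\<gamma> \<in> vec_lambda ` (PiE UNIV (\<lambda>_. {..d}))"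
      by (metis imageI vec_nth_inverse)
  qed
qed (intro finite_imageI finite_PiE; simp)

lemma size_exp_le_total_deg: "\<gamma> \<in> Poly_Mapping.keys h \<Longrightarrow> size_exp \<gamma> \<le> total_deg h"
  unfolding total_deg_def by (rule Max_ge) auto

lemma total_deg_le_half_deg: "total_deg h \<le> 2 * half_deg h"
  unfolding half_deg_def by linarith

lemma real_polynomial_function_poly_at:
  assumes "real_polynomial_function q"
  shows "\<exists>h :: ('n::finite) poly_ring. q = poly_at h"
  using assms
proof induction
  case (linear q)
  interpret bounded_linear q by fact
  have "q x = poly_at (\<Sum>i\<in>UNIV. Poly_Mapping.single (axis i 1) (q (axis i 1))) x" for x
  proof -
    have ax: "monom_at (axis i 1) x = x $ i" for i
    proof -
      have "monom_at (axis i 1) x = (\<Prod>j\<in>UNIV. if j = i then x $ j else 1)"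
        unfolding monom_at_def by (rule prod.cong) (auto simp: axis_def)
      then show ?thesis by simp
    qed
    have "q x = q (\<Sum>i\<in>UNIV. x $ i *\<^sub>R axis i 1)"
      using basis_expansion[of x] by (simp add: scalar_mult_eq_scaleR)
    also have "\<dots> = (\<Sum>i\<in>UNIV. x $ i * q (axis i 1))"
      by (simp add: sum scaleR)
    also have "\<dots> = poly_at (\<Sum>i\<in>UNIV. Poly_Mapping.single (axis i 1) (q (axis i 1))) x"
      using ax by (simp add: poly_at_riesz riesz_sum mult.commute)
    finally show ?thesis .
  qed
  then show ?case by blast
next
  case (const c)
  have "(\<lambda>x. c) = poly_at (Poly_Mapping.single 0 c)" by auto
  then show ?case by blast
next
  case (add q r)
  then obtain h k where "q = poly_at h" "r = poly_at k" by blast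
  then have "(\<lambda>x. q x + r x) = poly_at (h + k)" by auto
  then show ?case by blast
next
  case (mult q r)
  then obtain h k where "q = poly_at h" "r = poly_at k" by blast
  then have "(\<lambda>x. q x * r x) = poly_at (h * k)" by auto
  then show ?case by blast
qed

text \<open>The Stone-Weierstrass theorem in terms of the polynomial ring.\<close>

lemma poly_at_dense:
  fixes u :: "real ^ 'n::finite \<Rightarrow> real"
  assumes "compact B" "continuous_on B u" "0 < e"
  obtains h where "\<And>x. x \<in> B \<Longrightarrow> \<bar>u x - poly_at h x\<bar> \<le> e"
proof -
  obtain q where "real_polynomial_function q" "\<And>x. x \<in> B \<Longrightarrow> \<bar>u x - q x\<bar> < e"
    using Stone_Weierstrass_real_polynomial_function[OF assms] by blast
  with real_polynomial_function_poly_at[of q] that show thesis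
    by (metis less_imp_le)
qed

section \<open>Positive semidefinite moment matrices\<close>

text \<open>The quadratic form of the moment matrix at the coefficient vector of \<open>h\<close> is
  \<open>riesz y (h * h)\<close>; letting \<open>d\<close> grow exhausts all polynomials.\<close>

lemma psd_moment_riesz_iff:
  fixes y :: "nat ^ 'n::finite \<Rightarrow> real"
  shows "(\<forall>d. psd_on (exps_upto d) (moment_matrix y)) \<longleftrightarrow> (\<forall>h. 0 \<le> riesz y (h * h))"
proof (intro iffI allI)
  fix h :: "'n poly_ring" assume psd: "\<forall>d. psd_on (exps_upto d) (moment_matrix y)"
  let ?E = "exps_upto (total_deg h) :: (nat ^ 'n) set"
  have "Poly_Mapping.keys h \<subseteq> ?E"
    using size_exp_le_total_deg by (auto simp: exps_upto_def)
  then have "riesz y (h * h) = (\<Sum>a\<in>?E. \<Sum>b\<in>?E.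
      Poly_Mapping.lookup h a * y (a + b) * Poly_Mapping.lookup h b)"
    by (intro riesz_mult_expand finite_exps_upto)
  then show "0 \<le> riesz y (h * h)"
    using psd by (simp add: psd_on_def moment_matrix_def)
next
  fix d assume sq: "\<forall>h. 0 \<le> riesz y (h * h)"
  let ?E = "exps_upto d :: (nat ^ 'n) set"
  show "psd_on ?E (moment_matrix y)"
    unfolding psd_on_def
  proof (intro conjI allI ballI)
    fix v :: "nat ^ 'n \<Rightarrow> real"
    define h where "h = (\<Sum>a\<in>?E. Poly_Mapping.single a (v a))"
    have look: "Poly_Mapping.lookup h a = v a" if "a \<in> ?E" for a
      using that
      by (simp add: h_def finite_exps_upto lookup_sum lookup_single when_def sum.delta)
    have "Poly_Mapping.keys h \<subseteq> ?E"
      unfolding h_def by (rule order_trans[OF keys_sum]) auto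
    then have "riesz y (h * h) = (\<Sum>a\<in>?E. \<Sum>b\<in>?E.
        Poly_Mapping.lookup h a * y (a + b) * Poly_Mapping.lookup h b)"
      by (intro riesz_mult_expand finite_exps_upto)
    also have "\<dots> = (\<Sum>a\<in>?E. \<Sum>b\<in>?E. v a * moment_matrix y a b * v b)"
      by (intro sum.cong refl) (simp add: look moment_matrix_def)
    finally have "riesz y (h * h) = (\<Sum>a\<in>?E. \<Sum>b\<in>?E. v a * moment_matrix y a b * v b)" .
    with sq[rule_format, of h] show "0 \<le> (\<Sum>a\<in>?E. \<Sum>b\<in>?E. v a * moment_matrix y a b * v b)"
      by (rule ord_le_eq_trans)
  qed (simp add: moment_matrix_def add.commute)
qed

lemma psd_on_quadratic: "psd_on I A \<Longrightarrow> 0 \<le> (\<Sum>a\<in>I. \<Sum>b\<in>I. v a * A a b * v b)"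
  unfolding psd_on_def by blast

lemma psd_on_sym: "psd_on I A \<Longrightarrow> a \<in> I \<Longrightarrow> b \<in> I \<Longrightarrow> A a b = A b a"
  unfolding psd_on_def by blast

lemma psd_on_subset:
  assumes "psd_on J A" "I \<subseteq> J" "finite J"
  shows "psd_on I A"
  unfolding psd_on_def
proof (intro conjI allI ballI)
  fix v :: "'a \<Rightarrow> real"
  define w where "w a = (if a \<in> I then v a else 0)" for a
  have "0 \<le> (\<Sum>a\<in>J. \<Sum>b\<in>J. w a * A a b * w b)"
    using assms(1) by (simp add: psd_on_def)
  also have "\<dots> = (\<Sum>a\<in>I. \<Sum>b\<in>J. w a * A a b * w b)"
    by (rule sum.mono_neutral_right) (use assms in \<open>auto simp: w_def\<close>)
  also have "\<dots> = (\<Sum>a\<in>I. \<Sum>b\<in>I. w a * A a b * w b)"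
    by (intro sum.cong refl sum.mono_neutral_right) (use assms in \<open>auto simp: w_def\<close>)
  also have "\<dots> = (\<Sum>a\<in>I. \<Sum>b\<in>I. v a * A a b * v b)"
    by (intro sum.cong refl) (auto simp: w_def)
  finally show "0 \<le> (\<Sum>a\<in>I. \<Sum>b\<in>I. v a * A a b * v b)" .
next
  fix a b assume "a \<in> I" "b \<in> I"
  then show "A a b = A b a"
    using assms unfolding psd_on_def by blast
qed

lemma psd_on_diag:
  assumes "psd_on I A" "a \<in> I" "finite I"
  shows "0 \<le> A a a"
proof -
  have "psd_on {a} A" using psd_on_subset[OF assms(1)] assms by simp
  from psd_on_quadratic[OF this, of "\<lambda>_. 1"] show ?thesis by simp
qed

text \<open>Testing with the vectors \<open>e\<^sub>a + e\<^sub>b\<close> and \<open>e\<^sub>a - e\<^sub>b\<close> bounds the entry from both sides. This is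
  what confines all pseudo-moments once those of the form \<open>y (\<alpha> + \<alpha>)\<close> are confined.\<close>

lemma psd_on_entry_bound:
  assumes "psd_on I A" "a \<in> I" "b \<in> I" "finite I"
  shows "2 * \<bar>A a b\<bar> \<le> A a a + A b b"
proof (cases "a = b")
  case True
  then show ?thesis using psd_on_diag[OF assms(1,2,4)] by simp
next
  case False
  have psd: "psd_on {a, b} A" using psd_on_subset[OF assms(1)] assms by simp
  then have sym: "A b a = A a b" unfolding psd_on_def by blast
  have "0 \<le> (\<Sum>x\<in>{a,b}. \<Sum>y\<in>{a,b}. v x * A x y * v y)" for v
    using psd by (simp only: psd_on_def)
  from this[of "\<lambda>_. 1"] this[of "\<lambda>x. if x = a then 1 else -1"] show ?thesis
    using False sym by simp
qed

lemma psd_on_limit: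
  assumes "\<forall>\<^sub>F k in sequentially. psd_on I (A k)"
    and "\<And>a b. a \<in> I \<Longrightarrow> b \<in> I \<Longrightarrow> (\<lambda>k. A k a b) \<longlonglongrightarrow> A' a b"
  shows "psd_on I A'"
  unfolding psd_on_def
proof (intro conjI allI ballI)
  fix a b assume ab: "a \<in> I" "b \<in> I"
  have "\<forall>\<^sub>F k in sequentially. A k b a = A k a b"
    using assms(1) by eventually_elim (rule psd_on_sym[OF _ ab(2,1)])
  with assms(2)[OF ab(2,1)] have "(\<lambda>k. A k a b) \<longlonglongrightarrow> A' b a"
    by (rule Lim_transform_eventually)
  with assms(2)[OF ab] show "A' a b = A' b a"
    by (rule LIMSEQ_unique)
next
  fix v :: "'a \<Rightarrow> real"
  have "(\<lambda>k. \<Sum>a\<in>I. \<Sum>b\<in>I. v a * A k a b * v b) \<longlonglongrightarrow> (\<Sum>a\<in>I. \<Sum>b\<in>I. v a * A' a b * v b)"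
    by (intro tendsto_sum tendsto_mult tendsto_const assms(2))
  then show "0 \<le> (\<Sum>a\<in>I. \<Sum>b\<in>I. v a * A' a b * v b)"
  proof (rule tendsto_lowerbound)
    show "\<forall>\<^sub>F k in sequentially. 0 \<le> (\<Sum>a\<in>I. \<Sum>b\<in>I. v a * A k a b * v b)"
      using assms(1) by eventually_elim (rule psd_on_quadratic)
  qed simp
qed

section \<open>Functionals dominated by a measure on a compact set\<close>

lemma le_zero_of_small_multiples:
  fixes a C :: real
  assumes "\<And>t. 0 < t \<Longrightarrow> t \<le> 1 \<Longrightarrow> a \<le> C * t"
  shows "a \<le> 0"
proof (rule tendsto_lowerbound)
  show "((\<lambda>t. C * t) \<longlongrightarrow> 0) (at_right 0)"
    by (auto intro!: tendsto_eq_intros)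
  show "\<forall>\<^sub>F t in at_right 0. a \<le> C * t"
    unfolding eventually_at_right_field
    by (intro exI[of _ 1]) (auto intro: assms)
qed simp

locale compact_measure =
  fixes B :: "(real ^ 'n::finite) set" and \<mu> :: "(real ^ 'n) measure"
  assumes compact_B: "compact B"
    and sets_\<mu>: "sets \<mu> = sets borel"
    and finite_\<mu>: "finite_measure \<mu>"
    and null_outside: "emeasure \<mu> (- B) = 0"
begin

sublocale finite_measure \<mu> by (rule finite_\<mu>)

abbreviation "mass \<equiv> measure \<mu> UNIV"

lemma space_\<mu> [simp]: "space \<mu> = UNIV"
  using sets_eq_imp_space_eq[OF sets_\<mu>] by simp

lemma AE_B: "AE x in \<mu>. x \<in> B"
proof (rule AE_I[of _ _ "- B"])
  show "- B \<in> sets \<mu>"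
    using compact_imp_closed[OF compact_B] by (simp add: sets_\<mu>)
qed (use null_outside in auto)

lemma bounded_on_B:
  assumes "continuous_on UNIV (u :: real ^ 'n \<Rightarrow> real)"
  obtains K where "0 \<le> K" "\<And>x. x \<in> B \<Longrightarrow> \<bar>u x\<bar> \<le> K"
proof -
  have "bounded (u ` B)"
    by (intro compact_imp_bounded compact_continuous_image continuous_on_subset[OF assms] compact_B) auto
  then obtain K where "\<And>x. x \<in> B \<Longrightarrow> \<bar>u x\<bar> \<le> K"
    unfolding bounded_iff by auto
  then show thesis by (intro that[of "max 0 K"]) (auto intro: max.coboundedI2)
qed

lemma measurable_continuous:
  "continuous_on UNIV (u :: real ^ 'n \<Rightarrow> real) \<Longrightarrow> u \<in> borel_measurable \<mu>"
  using borel_measurable_continuous_onI measurable_cong_sets[OF sets_\<mu> refl] by blast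

lemma integrable_continuous:
  assumes "continuous_on UNIV (u :: real ^ 'n \<Rightarrow> real)"
  shows "integrable \<mu> u"
proof -
  obtain K where "\<And>x. x \<in> B \<Longrightarrow> \<bar>u x\<bar> \<le> K" using bounded_on_B[OF assms] by blast
  with AE_B have "AE x in \<mu>. norm (u x) \<le> K" by auto
  then show ?thesis
    by (rule integrable_const_bound) (rule measurable_continuous[OF assms])
qed

lemma set_integrable_continuous:
  "A \<in> sets borel \<Longrightarrow> continuous_on UNIV (u :: real ^ 'n \<Rightarrow> real) \<Longrightarrow> set_integrable \<mu> A u"
  unfolding set_integrable_def
  by (intro integrable_mult_indicator integrable_continuous) (auto simp: sets_\<mu>)

definition moments_on :: "(real ^ 'n) set \<Rightarrow> nat ^ 'n \<Rightarrow> real" where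
  "moments_on A \<alpha> = (LINT x:A|\<mu>. monom_at \<alpha> x)"

lemma moments_on_UNIV: "moments_on UNIV = moments \<mu>"
  by (intro ext) (simp add: moments_on_def moments_def set_lebesgue_integral_def)

lemma riesz_moments_on:
  assumes "A \<in> sets borel"
  shows "riesz (moments_on A) h = (LINT x:A|\<mu>. poly_at h x)"
proof -
  have "(LINT x:A|\<mu>. poly_at h x) = (LINT x|\<mu>. (\<Sum>\<gamma>\<in>Poly_Mapping.keys h.
      Poly_Mapping.lookup h \<gamma> * (indicator A x *\<^sub>R monom_at \<gamma> x)))"
    by (simp add: set_lebesgue_integral_def poly_at_def sum_distrib_left mult_ac)
  also have "\<dots> = (\<Sum>\<gamma>\<in>Poly_Mapping.keys h. Poly_Mapping.lookup h \<gamma> * moments_on A \<gamma>)"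
    unfolding moments_on_def set_lebesgue_integral_def
    using set_integrable_continuous[OF assms continuous_monom_at]
    by (subst Bochner_Integration.integral_sum) (simp_all add: set_integrable_def)
  finally show ?thesis by (simp add: riesz_def)
qed

lemma riesz_moments_square_nonneg:
  "A \<in> sets borel \<Longrightarrow> 0 \<le> riesz (moments_on A) (h * h)"
  by (auto simp: riesz_moments_on set_lebesgue_integral_def)

definition sup_bound :: "real \<Rightarrow> (nat ^ 'n \<Rightarrow> real) \<Rightarrow> bool" where
  "sup_bound M y \<longleftrightarrow>
     0 \<le> M \<and> (\<forall>h e. 0 \<le> e \<longrightarrow> (\<forall>x\<in>B. \<bar>poly_at h x\<bar> \<le> e) \<longrightarrow> \<bar>riesz y h\<bar> \<le> M * e)"

lemma sup_boundD:
  "sup_bound M y \<Longrightarrow> 0 \<le> e \<Longrightarrow> (\<And>x. x \<in> B \<Longrightarrow> \<bar>poly_at h x\<bar> \<le> e) \<Longrightarrow> \<bar>riesz y h\<bar> \<le> M * e"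
  unfolding sup_bound_def by blast

text \<open>Expanding \<open>(h \<pm> e)\<^sup>2\<close> and using \<open>riesz y (h\<^sup>2) \<le> e\<^sup>2 mass\<close> and \<open>y 0 \<le> mass\<close> gives the bound when
  \<open>e > 0\<close>; this is how the
  Cauchy-Schwarz inequality is proved for the form \<open>(h, k) \<mapsto> riesz y (h k)\<close>. The
  case \<open>e = 0\<close> follows by letting \<open>e\<close> tend to \<open>0\<close>, and it says that \<open>riesz y h\<close> depends only on the
  values of \<open>h\<close> on \<open>B\<close>.\<close>

lemma sup_bound_dominated:
  assumes sq: "\<And>h. 0 \<le> riesz y (h * h)"
    and dom: "\<And>h. riesz y (h * h) \<le> (LINT x|\<mu>. poly_at (h * h) x)"
  shows "sup_bound mass y"
proof -
  have pos: "\<bar>riesz y h\<bar> \<le> mass * e" if e: "0 < e" and h: "\<And>x. x \<in> B \<Longrightarrow> \<bar>poly_at h x\<bar> \<le> e" for h e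
  proof -
    have "y 0 = riesz y (Poly_Mapping.single 0 1 * Poly_Mapping.single 0 1)"
      by (simp add: mult_single)
    also have "\<dots> \<le> mass"
      using dom[of "Poly_Mapping.single 0 1"] by simp
    finally have one: "y 0 \<le> mass" .
    have "(LINT x|\<mu>. poly_at (h * h) x) \<le> (LINT x|\<mu>. e\<^sup>2)"
    proof (rule integral_mono_AE)
      show "AE x in \<mu>. poly_at (h * h) x \<le> e\<^sup>2"
        using AE_B
      proof eventually_elim
        case (elim x)
        show ?case using power_mono[OF h[OF elim], of 2] by (simp add: power2_eq_square)
      qed
    qed (auto intro!: integrable_continuous continuous_intros)
    with dom[of h] have hh: "riesz y (h * h) \<le> e\<^sup>2 * mass" by (simp add: mult.commute)
    have exp: "riesz y ((h + Poly_Mapping.single 0 c) * (h + Poly_Mapping.single 0 c))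
        = riesz y (h * h) + 2 * c * riesz y h + c\<^sup>2 * y 0" for c
    proof -
      have "(h + Poly_Mapping.single 0 c) * (h + Poly_Mapping.single 0 c) = h * h +
          Poly_Mapping.single 0 c * h + Poly_Mapping.single 0 c * h + Poly_Mapping.single 0 (c * c)"
        by (simp add: algebra_simps mult_single)
      then show ?thesis
        by (simp only: riesz_add riesz_const_mult riesz_single power2_eq_square)
    qed
    have up: "0 \<le> riesz y (h * h) + 2 * e * riesz y h + e\<^sup>2 * y 0"
      using sq[of "h + Poly_Mapping.single 0 e"] by (simp only: exp)
    have lo: "0 \<le> riesz y (h * h) + 2 * (- e) * riesz y h + (- e)\<^sup>2 * y 0"
      using sq[of "h + Poly_Mapping.single 0 (- e)"] by (simp only: exp)
    have "e\<^sup>2 * y 0 \<le> e\<^sup>2 * mass" using one by (intro mult_left_mono) auto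
    with up lo hh have "2 * e * \<bar>riesz y h\<bar> \<le> 2 * e * (mass * e)"
      by (auto simp: abs_if power2_eq_square algebra_simps)
    with e show ?thesis by simp
  qed
  have "\<bar>riesz y h\<bar> \<le> mass * e" if e: "0 \<le> e" and h: "\<And>x. x \<in> B \<Longrightarrow> \<bar>poly_at h x\<bar> \<le> e" for h e
  proof -
    have "\<bar>riesz y h\<bar> - mass * e \<le> mass * t" if "0 < t" for t
      using pos[of "e + t" h] that e h by (force simp: algebra_simps)
    then show ?thesis
      using le_zero_of_small_multiples[of "\<bar>riesz y h\<bar> - mass * e" mass] by simp
  qed
  then show ?thesis unfolding sup_bound_def by auto
qed

lemma sup_bound_localized:
  assumes "sup_bound M y"
  obtains M' where "sup_bound M' (localized q y)"
proof -
  obtain G where G: "0 \<le> G" "\<And>x. x \<in> B \<Longrightarrow> \<bar>poly_at q x\<bar> \<le> G"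
    using bounded_on_B[of "poly_at q"] continuous_poly_at by blast
  have "\<bar>riesz (localized q y) h\<bar> \<le> (M * G) * e"
    if "0 \<le> e" and h: "\<And>x. x \<in> B \<Longrightarrow> \<bar>poly_at h x\<bar> \<le> e" for h e
    using sup_boundD[OF assms, of "G * e" "q * h"] G h that
    by (simp add: riesz_localized abs_mult mult_mono mult.assoc)
  with G assms have "sup_bound (M * G) (localized q y)" unfolding sup_bound_def by auto
  then show thesis by (rule that)
qed

text \<open>The square root of \<open>h\<close> is continuous on \<open>B\<close>, hence uniformly close to a polynomial \<open>q\<close>, and
  then \<open>h\<close> is uniformly close to \<open>q\<^sup>2\<close>.\<close>

lemma riesz_nonneg_of_squares:
  assumes bnd: "sup_bound M y" and sq: "\<And>h. 0 \<le> riesz y (h * h)"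
    and h: "\<And>x. x \<in> B \<Longrightarrow> 0 \<le> poly_at h x"
  shows "0 \<le> riesz y h"
proof -
  define u where "u x = sqrt (poly_at h x)" for x
  have u: "continuous_on UNIV u" unfolding u_def by (intro continuous_intros)
  obtain K where K: "0 \<le> K" "\<And>x. x \<in> B \<Longrightarrow> \<bar>u x\<bar> \<le> K" using bounded_on_B[OF u] by blast
  have "- riesz y h \<le> (M * (2 * K + 1)) * t" if t: "0 < t" "t \<le> 1" for t
  proof -
    obtain q where q: "\<And>x. x \<in> B \<Longrightarrow> \<bar>u x - poly_at q x\<bar> \<le> t"
      using poly_at_dense[OF compact_B continuous_on_subset[OF u] t(1)] by blast
    have "\<bar>riesz y (q * q - h)\<bar> \<le> M * ((2 * K + 1) * t)"
    proof (rule sup_boundD[OF bnd])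
      fix x assume x: "x \<in> B"
      have hu: "poly_at h x = u x * u x" using h[OF x] by (simp add: u_def)
      have "\<bar>poly_at (q * q - h) x\<bar> = \<bar>poly_at q x + u x\<bar> * \<bar>u x - poly_at q x\<bar>"
        unfolding abs_mult[symmetric] by (simp add: hu algebra_simps abs_minus_commute)
      also have "\<dots> \<le> (2 * K + 1) * t"
        using K(1) K(2)[OF x] q[OF x] t by (intro mult_mono) auto
      finally show "\<bar>poly_at (q * q - h) x\<bar> \<le> (2 * K + 1) * t" .
    qed (use K t in auto)
    then show ?thesis using sq[of q] by (simp add: riesz_diff mult.assoc)
  qed
  then show ?thesis
    using le_zero_of_small_multiples[of "- riesz y h" "M * (2 * K + 1)"] by simp
qed

text \<open>\<open>T\<close> extends \<open>riesz y\<close> to the continuous functions and is Lipschitz with constant \<open>M\<close> for the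
  uniform norm on \<open>B\<close>. Comparing \<open>T\<close> only with polynomials determines \<open>T u\<close> by density, and
  linearity and positivity follow from this comparison alone. The functions are required
  to be continuous on the whole space so that they are Borel measurable; only their values
  on \<open>B\<close> matter.\<close>

definition extends :: "real \<Rightarrow> (nat ^ 'n \<Rightarrow> real) \<Rightarrow> ((real ^ 'n \<Rightarrow> real) \<Rightarrow> real) \<Rightarrow> bool" where
  "extends M y T \<longleftrightarrow> 0 \<le> M \<and> (\<forall>u h e. continuous_on UNIV u \<longrightarrow> 0 \<le> e \<longrightarrow>
     (\<forall>x\<in>B. \<bar>u x - poly_at h x\<bar> \<le> e) \<longrightarrow> \<bar>T u - riesz y h\<bar> \<le> M * e)"

lemma extendsD:
  "extends M y T \<Longrightarrow> continuous_on UNIV u \<Longrightarrow> 0 \<le> e \<Longrightarrow>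
    (\<And>x. x \<in> B \<Longrightarrow> \<bar>u x - poly_at h x\<bar> \<le> e) \<Longrightarrow> \<bar>T u - riesz y h\<bar> \<le> M * e"
  unfolding extends_def by blast

text \<open>A value \<open>T u\<close> must lie in all intervals of radius \<open>M e\<close> around \<open>riesz y h\<close>, where \<open>h\<close> is within
  \<open>e\<close> of \<open>u\<close> on \<open>B\<close>. Any two of these intervals meet, so the supremum of their left ends
  lies in all of them.\<close>

lemma extension_exists:
  assumes bnd: "sup_bound M y"
  shows "\<exists>T. extends M y T"
proof -
  have M: "0 \<le> M" using bnd by (simp add: sup_bound_def)
  have "\<exists>l. \<forall>h e. 0 \<le> e \<longrightarrow> (\<forall>x\<in>B. \<bar>u x - poly_at h x\<bar> \<le> e) \<longrightarrow> \<bar>l - riesz y h\<bar> \<le> M * e"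
    if u: "continuous_on UNIV u" for u
  proof -
    define S where
      "S = {riesz y h - M * e |h e. 0 \<le> e \<and> (\<forall>x\<in>B. \<bar>u x - poly_at h x\<bar> \<le> e)}"
    have cross: "riesz y h - M * e \<le> riesz y k + M * e'"
      if "0 \<le> e" "\<forall>x\<in>B. \<bar>u x - poly_at h x\<bar> \<le> e" "0 \<le> e'" "\<forall>x\<in>B. \<bar>u x - poly_at k x\<bar> \<le> e'"
      for h k e e'
    proof -
      have "\<bar>riesz y (h - k)\<bar> \<le> M * (e + e')"
      proof (rule sup_boundD[OF bnd])
        fix x assume "x \<in> B"
        with that(2,4) have "\<bar>u x - poly_at h x\<bar> \<le> e" "\<bar>u x - poly_at k x\<bar> \<le> e'" by auto
        then show "\<bar>poly_at (h - k) x\<bar> \<le> e + e'" by simp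
      qed (use that in simp)
      then show ?thesis by (simp add: riesz_diff algebra_simps)
    qed
    obtain K where K: "0 \<le> K" "\<And>x. x \<in> B \<Longrightarrow> \<bar>u x\<bar> \<le> K" using bounded_on_B[OF u] by blast
    then have "riesz y 0 - M * K \<in> S" unfolding S_def by (intro CollectI exI[of _ 0] exI[of _ K] conjI refl) auto
    then have ne: "S \<noteq> {}" by blast
    have low: "s \<le> riesz y k + M * e'"
      if "s \<in> S" "0 \<le> e'" "\<forall>x\<in>B. \<bar>u x - poly_at k x\<bar> \<le> e'" for s k e'
      using that cross unfolding S_def by blast
    have bdd: "bdd_above S"
      by (rule bdd_aboveI[of _ "riesz y 0 + M * K"]) (rule low, use K in auto)
    have "\<bar>Sup S - riesz y h\<bar> \<le> M * e"
      if "0 \<le> e" "\<forall>x\<in>B. \<bar>u x - poly_at h x\<bar> \<le> e" for h e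
    proof -
      have "riesz y h - M * e \<le> Sup S"
        by (rule cSup_upper[OF _ bdd]) (use that S_def in blast)
      moreover have "Sup S \<le> riesz y h + M * e"
        by (rule cSup_least[OF ne]) (rule low[OF _ that])
      ultimately show ?thesis by linarith
    qed
    then show ?thesis by blast
  qed
  then obtain T where "\<And>u h e. continuous_on UNIV u \<Longrightarrow> 0 \<le> e \<Longrightarrow>
      (\<forall>x\<in>B. \<bar>u x - poly_at h x\<bar> \<le> e) \<Longrightarrow> \<bar>T u - riesz y h\<bar> \<le> M * e" by metis
  with M show ?thesis unfolding extends_def by blast
qed

lemma extends_poly: "extends M y T \<Longrightarrow> T (poly_at h) = riesz y h"
  using extendsD[of M y T "poly_at h" 0 h] by (simp add: continuous_poly_at)

lemma extends_sum:
  assumes "\<And>i. i \<in> I \<Longrightarrow> extends (M i) (y i) (T i)"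
  shows "extends (sum M I) (\<lambda>\<alpha>. \<Sum>i\<in>I. y i \<alpha>) (\<lambda>u. \<Sum>i\<in>I. T i u)"
  unfolding extends_def
proof (intro conjI allI impI)
  show "0 \<le> sum M I" using assms by (intro sum_nonneg) (auto simp: extends_def)
next
  fix u h e assume u: "continuous_on UNIV u" "0 \<le> e" "\<forall>x\<in>B. \<bar>u x - poly_at h x\<bar> \<le> e"
  have "\<bar>\<Sum>i\<in>I. (T i u - riesz (y i) h)\<bar> \<le> (\<Sum>i\<in>I. M i * e)"
    by (rule order_trans[OF sum_abs sum_mono]) (rule extendsD[OF assms], use u in auto)
  then show "\<bar>(\<Sum>i\<in>I. T i u) - riesz (\<lambda>\<alpha>. \<Sum>i\<in>I. y i \<alpha>) h\<bar> \<le> sum M I * e"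
    by (simp add: riesz_sum_seq sum_subtractf sum_distrib_right)
qed

text \<open>Homogeneity is left out: only multiples by natural numbers occur, and these follow from
  additivity.\<close>

definition positive_functional :: "((real ^ 'n \<Rightarrow> real) \<Rightarrow> real) \<Rightarrow> bool" where
  "positive_functional T \<longleftrightarrow>
     (\<forall>u v. continuous_on UNIV u \<longrightarrow> continuous_on UNIV v \<longrightarrow>
        T (\<lambda>x. u x + v x) = T u + T v) \<and>
     (\<forall>u. continuous_on UNIV u \<longrightarrow> (\<forall>x\<in>B. 0 \<le> u x) \<longrightarrow> 0 \<le> T u)"

lemma positive_functional_add:
  "positive_functional T \<Longrightarrow> continuous_on UNIV u \<Longrightarrow> continuous_on UNIV v \<Longrightarrow>
    T (\<lambda>x. u x + v x) = T u + T v"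
  unfolding positive_functional_def by blast

lemma positive_functional_nonneg:
  "positive_functional T \<Longrightarrow> continuous_on UNIV u \<Longrightarrow> (\<And>x. x \<in> B \<Longrightarrow> 0 \<le> u x) \<Longrightarrow> 0 \<le> T u"
  unfolding positive_functional_def by blast

lemma positive_functional_diff:
  assumes "positive_functional T" "continuous_on UNIV u" "continuous_on UNIV v"
  shows "T (\<lambda>x. u x - v x) = T u - T v"
  using positive_functional_add[OF assms(1), of "\<lambda>x. u x - v x" v] assms
  by (simp add: continuous_intros)

lemma positive_functional_mono:
  assumes "positive_functional T" "continuous_on UNIV u" "continuous_on UNIV v"
    and "\<And>x. x \<in> B \<Longrightarrow> u x \<le> v x"
  shows "T u \<le> T v"
  using positive_functional_nonneg[OF assms(1), of "\<lambda>x. v x - u x"] assms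
  by (simp add: positive_functional_diff continuous_intros)

lemma positive_functional_zero: "positive_functional T \<Longrightarrow> T (\<lambda>_. 0) = 0"
  using positive_functional_add[of T "\<lambda>_. 0" "\<lambda>_. 0"] by simp

lemma positive_functional_sum:
  assumes T: "positive_functional T" and "\<And>j. j \<in> J \<Longrightarrow> continuous_on UNIV (u j)"
  shows "T (\<lambda>x. \<Sum>j\<in>J. u j x) = (\<Sum>j\<in>J. T (u j))"
  using assms(2)
proof (induction J rule: infinite_finite_induct)
  case (insert j J)
  then show ?case
    by (simp add: positive_functional_add[OF T] continuous_on_sum)
qed (simp_all add: positive_functional_zero[OF T])

text \<open>A positive functional with \<open>T v = 0\<close> kills every function between \<open>0\<close> and a multiple of \<open>v\<close>,
  such as \<open>min u (n v)\<close>. What remains is \<open>u - min u (n v)\<close>, which for large \<open>n\<close> is concentrated on the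
  zero set of \<open>v\<close>; dominated convergence turns the bound by \<open>\<mu>\<close> on \<open>A\<close> into a bound on the
  smaller set.\<close>

lemma positive_functional_vanishing:
  assumes T: "positive_functional T" and A: "A \<in> sets borel"
    and le: "\<And>u. continuous_on UNIV u \<Longrightarrow> (\<And>x. x \<in> B \<Longrightarrow> 0 \<le> u x) \<Longrightarrow> T u \<le> (LINT x:A|\<mu>. u x)"
    and v: "continuous_on UNIV v" "\<And>x. x \<in> B \<Longrightarrow> 0 \<le> v x" "T v = 0"
    and u: "continuous_on UNIV u" "\<And>x. x \<in> B \<Longrightarrow> 0 \<le> u x"
  shows "T u \<le> (LINT x:(A \<inter> {x. v x = 0})|\<mu>. u x)"
proof -
  define w where "w n x = min (u x) (real n * v x)" for n x
  have w: "continuous_on UNIV (w n)" for n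
    unfolding w_def by (intro continuous_intros u v)
  have nv: "continuous_on UNIV (\<lambda>x. real n * v x)" for n
    by (intro continuous_intros v)
  have Tnv: "T (\<lambda>x. real n * v x) = 0" for n
  proof (induction n)
    case 0
    then show ?case using positive_functional_zero[OF T] by simp
  next
    case (Suc n)
    have "T (\<lambda>x. real (Suc n) * v x) = T (\<lambda>x. real n * v x + v x)"
      by (simp add: algebra_simps)
    also have "\<dots> = 0"
      using positive_functional_add[OF T nv[of n] v(1)] Suc v(3) by simp
    finally show ?case .
  qed
  have bound: "T u \<le> (LINT x:A|\<mu>. u x - w n x)" for n
  proof -
    have "T (w n) \<le> T (\<lambda>x. real n * v x)"
      by (rule positive_functional_mono[OF T w nv]) (simp add: w_def)
    then have "T u \<le> T (\<lambda>x. u x - w n x)"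
      using positive_functional_diff[OF T u(1) w[of n]] Tnv[of n] by simp
    also have "\<dots> \<le> (LINT x:A|\<mu>. u x - w n x)"
      by (rule le) (auto intro!: continuous_intros u(1) w, auto simp: w_def)
    finally show ?thesis .
  qed
  have A': "A \<in> sets \<mu>" using A by (simp add: sets_\<mu>)
  have meas: "A \<inter> {x. v x = 0} \<in> sets \<mu>"
  proof -
    have "closed {x. v x = 0}"
      using closed_Collect_eq[OF v(1), of "\<lambda>_. 0"] by simp
    then show ?thesis using A by (auto simp: sets_\<mu>)
  qed
  have "(\<lambda>n. LINT x:A|\<mu>. u x - w n x) \<longlonglongrightarrow> (LINT x:(A \<inter> {x. v x = 0})|\<mu>. u x)"
    unfolding set_lebesgue_integral_def
  proof (rule integral_dominated_convergence[where w = "\<lambda>x. \<bar>u x\<bar>"])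
    show "(\<lambda>x. indicator (A \<inter> {x. v x = 0}) x *\<^sub>R u x) \<in> borel_measurable \<mu>"
      using meas measurable_continuous[OF u(1)] by (intro borel_measurable_scaleR) auto
    show "(\<lambda>x. indicator A x *\<^sub>R (u x - w n x)) \<in> borel_measurable \<mu>" for n
      using A' measurable_continuous[OF u(1)] measurable_continuous[OF w]
      by (intro borel_measurable_scaleR borel_measurable_diff) auto
    show "integrable \<mu> (\<lambda>x. \<bar>u x\<bar>)" by (intro integrable_continuous continuous_intros u)
    show "AE x in \<mu>. norm (indicator A x *\<^sub>R (u x - w n x)) \<le> \<bar>u x\<bar>" for n
      using AE_B
    proof eventually_elim
      case (elim x)
      have "0 \<le> real n * v x" using v(2)[OF elim] by simp
      then show ?case using u(2)[OF elim] by (auto simp: indicator_def w_def min_def)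
    qed
    show "AE x in \<mu>. (\<lambda>n. indicator A x *\<^sub>R (u x - w n x))
        \<longlonglongrightarrow> indicator (A \<inter> {x. v x = 0}) x *\<^sub>R u x"
      using AE_B
    proof eventually_elim
      case (elim x)
      show ?case
      proof (cases "v x = 0")
        case True
        then have "w n x = 0" for n using u(2)[OF elim] by (simp add: w_def)
        with True show ?thesis by (simp add: indicator_def)
      next
        case False
        with v(2)[OF elim] have pos: "0 < v x" by simp
        then obtain N where N: "u x < real N * v x" using reals_Archimedean3 by blast
        have "w n x = u x" if "N \<le> n" for n
        proof -
          have "real N * v x \<le> real n * v x" using that pos by simp
          with N show ?thesis by (simp add: w_def)
        qed
        then have "\<forall>\<^sub>F n in sequentially. indicator A x *\<^sub>R (u x - w n x) = 0"
          unfolding eventually_sequentially by (intro exI[of _ N]) auto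
        then have "(\<lambda>n. indicator A x *\<^sub>R (u x - w n x)) \<longlonglongrightarrow> 0"
          by (rule tendsto_eventually)
        with False show ?thesis by (simp add: indicator_def)
      qed
    qed
  qed
  then show ?thesis by (rule LIMSEQ_le_const) (use bound in auto)
qed

text \<open>Approximation from above keeps a nonnegative function nonnegative, so that hypotheses on
  nonnegative polynomials can be applied to the approximation.\<close>

lemma dense_above:
  assumes "continuous_on UNIV u" "0 < t"
  obtains h where "\<And>x. x \<in> B \<Longrightarrow> u x \<le> poly_at h x" "\<And>x. x \<in> B \<Longrightarrow> poly_at h x \<le> u x + 2 * t"
proof -
  obtain q where q: "\<And>x. x \<in> B \<Longrightarrow> \<bar>u x - poly_at q x\<bar> \<le> t"
    using poly_at_dense[OF compact_B continuous_on_subset[OF assms(1)] assms(2)] by blast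
  show thesis
    by (rule that[of "q + Poly_Mapping.single 0 t"]) (use q in \<open>force simp: abs_le_iff\<close>)+
qed

text \<open>Passes a localizing constraint from polynomials to continuous functions; with \<open>q = 1\<close>
  it gives positivity of the extension.\<close>

lemma extends_localized_nonneg:
  assumes T: "extends M y T"
    and loc: "\<And>h. (\<And>x. x \<in> B \<Longrightarrow> 0 \<le> poly_at h x) \<Longrightarrow> 0 \<le> riesz y (q * h)"
    and u: "continuous_on UNIV u" "\<And>x. x \<in> B \<Longrightarrow> 0 \<le> u x"
  shows "0 \<le> T (\<lambda>x. poly_at q x * u x)"
proof -
  obtain G where G: "0 \<le> G" "\<And>x. x \<in> B \<Longrightarrow> \<bar>poly_at q x\<bar> \<le> G"
    using bounded_on_B[of "poly_at q"] continuous_poly_at by blast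
  have "- T (\<lambda>x. poly_at q x * u x) \<le> (M * G * 2) * t" if t: "0 < t" for t
  proof -
    obtain h where h: "\<And>x. x \<in> B \<Longrightarrow> u x \<le> poly_at h x" "\<And>x. x \<in> B \<Longrightarrow> poly_at h x \<le> u x + 2 * t"
      using dense_above[OF u(1) t] by blast
    have "\<bar>T (\<lambda>x. poly_at q x * u x) - riesz y (q * h)\<bar> \<le> M * (G * (2 * t))"
    proof (rule extendsD[OF T])
      fix x assume x: "x \<in> B"
      have "\<bar>poly_at q x * (u x - poly_at h x)\<bar> \<le> G * (2 * t)"
        unfolding abs_mult using G(1) G(2)[OF x] h(1)[OF x] h(2)[OF x] by (intro mult_mono) auto
      then show "\<bar>poly_at q x * u x - poly_at (q * h) x\<bar> \<le> G * (2 * t)"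
        by (simp add: right_diff_distrib)
    qed (use G t in \<open>auto intro!: continuous_intros u\<close>)
    moreover have "0 \<le> riesz y (q * h)"
      by (rule loc) (use h(1) u(2) order_trans in blast)
    ultimately show ?thesis by (simp add: mult.assoc)
  qed
  then show ?thesis
    using le_zero_of_small_multiples[of "- T (\<lambda>x. poly_at q x * u x)" "M * G * 2"] by simp
qed

lemma extends_positive_functional:
  assumes T: "extends M y T"
    and pos: "\<And>h. (\<And>x. x \<in> B \<Longrightarrow> 0 \<le> poly_at h x) \<Longrightarrow> 0 \<le> riesz y h"
  shows "positive_functional T"
  unfolding positive_functional_def
proof (intro conjI allI impI)
  fix u v assume u: "continuous_on UNIV (u :: real ^ 'n \<Rightarrow> real)" and v: "continuous_on UNIV (v :: real ^ 'n \<Rightarrow> real)"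
  have "\<bar>T (\<lambda>x. u x + v x) - (T u + T v)\<bar> \<le> (4 * M) * t" if t: "0 < t" for t
  proof -
    obtain h k where hk: "\<And>x. x \<in> B \<Longrightarrow> \<bar>u x - poly_at h x\<bar> \<le> t" "\<And>x. x \<in> B \<Longrightarrow> \<bar>v x - poly_at k x\<bar> \<le> t"
      using poly_at_dense[OF compact_B continuous_on_subset[OF u] t]
        poly_at_dense[OF compact_B continuous_on_subset[OF v] t] by (metis subset_UNIV)
    have "\<bar>T u - riesz y h\<bar> \<le> M * t" "\<bar>T v - riesz y k\<bar> \<le> M * t"
      using hk t by (auto intro!: extendsD[OF T] u v)
    moreover have "\<bar>T (\<lambda>x. u x + v x) - riesz y (h + k)\<bar> \<le> M * (2 * t)"
    proof (rule extendsD[OF T])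
      fix x assume "x \<in> B"
      from hk[OF this] show "\<bar>u x + v x - poly_at (h + k) x\<bar> \<le> 2 * t" by simp
    qed (use t in \<open>auto intro!: continuous_intros u v\<close>)
    ultimately show ?thesis by (simp add: riesz_add)
  qed
  then show "T (\<lambda>x. u x + v x) = T u + T v"
    using le_zero_of_small_multiples[of "\<bar>T (\<lambda>x. u x + v x) - (T u + T v)\<bar>" "4 * M"] by simp
next
  fix u :: "real ^ 'n \<Rightarrow> real" assume u: "continuous_on UNIV u" "\<forall>x\<in>B. 0 \<le> u x"
  have "0 \<le> T (\<lambda>x. poly_at (Poly_Mapping.single 0 1) x * u x)"
    by (rule extends_localized_nonneg[OF T _ u(1)]) (use pos u in \<open>auto simp: riesz_const_mult\<close>)
  then show "0 \<le> T u" by simp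
qed

lemma extends_le_integral:
  assumes T: "extends M y T"
    and le: "\<And>h. (\<And>x. x \<in> B \<Longrightarrow> 0 \<le> poly_at h x) \<Longrightarrow> riesz y h \<le> (LINT x|\<mu>. poly_at h x)"
    and u: "continuous_on UNIV u" "\<And>x. x \<in> B \<Longrightarrow> 0 \<le> u x"
  shows "T u \<le> (LINT x|\<mu>. u x)"
proof -
  have "T u - (LINT x|\<mu>. u x) \<le> (2 * M + 2 * mass) * t" if t: "0 < t" for t
  proof -
    obtain h where h: "\<And>x. x \<in> B \<Longrightarrow> u x \<le> poly_at h x" "\<And>x. x \<in> B \<Longrightarrow> poly_at h x \<le> u x + 2 * t"
      using dense_above[OF u(1) t] by blast
    have "\<bar>T u - riesz y h\<bar> \<le> M * (2 * t)"
      by (rule extendsD[OF T u(1)]) (use h t in \<open>force simp: abs_le_iff\<close>)+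
    moreover have "riesz y h \<le> (LINT x|\<mu>. poly_at h x)"
      by (rule le) (use h(1) u(2) order_trans in blast)
    moreover have "(LINT x|\<mu>. poly_at h x) \<le> (LINT x|\<mu>. u x + 2 * t)"
    proof (rule integral_mono_AE)
      show "AE x in \<mu>. poly_at h x \<le> u x + 2 * t" using AE_B by eventually_elim (rule h(2))
    qed (auto intro!: integrable_continuous continuous_intros u)
    moreover have "(LINT x|\<mu>. u x + 2 * t) = (LINT x|\<mu>. u x) + 2 * t * mass"
      using integrable_continuous[OF u(1)] by simp
    ultimately show ?thesis by (simp add: algebra_simps)
  qed
  then show ?thesis
    using le_zero_of_small_multiples[of "T u - (LINT x|\<mu>. u x)" "2 * M + 2 * mass"] by simp
qed

lemma set_integral_cong_AE_real:
  assumes "A \<in> sets borel" "continuous_on UNIV u" "continuous_on UNIV v"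
    and "AE x in \<mu>. x \<in> A \<longrightarrow> u x = (v x :: real)"
  shows "(LINT x:A|\<mu>. u x) = (LINT x:A|\<mu>. v x)"
  by (rule set_lebesgue_integral_cong_AE)
    (use assms in \<open>auto simp: sets_\<mu> intro: measurable_continuous\<close>)

text \<open>The localizing constraints confine the functional to \<open>\<Omega>\<close>. Let \<open>n\<^sub>i\<^sub>j\<close> be the negative part of
  \<open>q\<^sub>i\<^sub>j\<close> and \<open>w \<ge> 0\<close>. Testing the constraint with \<open>n\<^sub>i\<^sub>j w\<close> gives \<open>T\<^sub>i (n\<^sub>i\<^sub>j\<^sup>2 w) \<le> 0\<close>, because
  \<open>q\<^sub>i\<^sub>j n\<^sub>i\<^sub>j = - n\<^sub>i\<^sub>j\<^sup>2\<close>. The function \<open>V\<close>, the product over \<open>i\<close> of the sums over \<open>j\<close> of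
  \<open>n\<^sub>i\<^sub>j\<^sup>2\<close>, vanishes exactly on the union \<open>\<Omega>\<close>, and for each \<open>i\<close> it is a sum of functions
  \<open>n\<^sub>i\<^sub>j\<^sup>2 w\<close>, so every \<open>T\<^sub>i\<close>, and hence their sum, vanishes at \<open>V\<close>.\<close>

lemma positive_functional_of_moments:
  fixes Y :: "'i \<Rightarrow> nat ^ 'n \<Rightarrow> real" and q :: "'i \<Rightarrow> 'j \<Rightarrow> 'n poly_ring"
  assumes fin: "finite I" "\<And>i. i \<in> I \<Longrightarrow> finite (J i)"
    and sq: "\<And>i h. i \<in> I \<Longrightarrow> 0 \<le> riesz (Y i) (h * h)"
    and loc: "\<And>i j h. i \<in> I \<Longrightarrow> j \<in> J i \<Longrightarrow> 0 \<le> riesz (localized (q i j) (Y i)) (h * h)"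
    and dom: "\<And>h. (\<Sum>i\<in>I. riesz (Y i) (h * h)) \<le> (LINT x|\<mu>. poly_at (h * h) x)"
    and \<Omega>: "\<Omega> = (\<Union>i\<in>I. {x. \<forall>j\<in>J i. 0 \<le> poly_at (q i j) x})"
  shows "\<exists>T. positive_functional T \<and> (\<forall>h. T (poly_at h) = (\<Sum>i\<in>I. riesz (Y i) h)) \<and>
    (\<forall>u. continuous_on UNIV u \<longrightarrow> (\<forall>x\<in>B. 0 \<le> u x) \<longrightarrow> T u \<le> (LINT x:\<Omega>|\<mu>. u x))"
proof -
  have dom_i: "riesz (Y i) (h * h) \<le> (LINT x|\<mu>. poly_at (h * h) x)" if "i \<in> I" for i h
    using member_le_sum[of i I "\<lambda>i. riesz (Y i) (h * h)"] that sq fin(1) dom[of h] by force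
  have bnd: "sup_bound mass (Y i)" if "i \<in> I" for i
    by (rule sup_bound_dominated) (rule sq dom_i that)+
  then have "\<exists>T. \<forall>i\<in>I. extends mass (Y i) (T i)"
    using extension_exists by (intro bchoice) auto
  then obtain T where T: "\<And>i. i \<in> I \<Longrightarrow> extends mass (Y i) (T i)" by blast
  have pos: "0 \<le> riesz (Y i) h" if "i \<in> I" "\<And>x. x \<in> B \<Longrightarrow> 0 \<le> poly_at h x" for i h
    by (rule riesz_nonneg_of_squares[OF bnd sq]) (use that in auto)
  have locpos: "0 \<le> riesz (Y i) (q i j * h)"
    if ij: "i \<in> I" "j \<in> J i" and h: "\<And>x. x \<in> B \<Longrightarrow> 0 \<le> poly_at h x" for i j h
  proof -
    obtain M' where "sup_bound M' (localized (q i j) (Y i))"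
      using sup_bound_localized[OF bnd[OF ij(1)]] by blast
    then have "0 \<le> riesz (localized (q i j) (Y i)) h"
      by (rule riesz_nonneg_of_squares) (use loc ij h in auto)
    then show ?thesis by (simp add: riesz_localized)
  qed
  have le: "(\<Sum>i\<in>I. riesz (Y i) h) \<le> (LINT x|\<mu>. poly_at h x)"
    if h: "\<And>x. x \<in> B \<Longrightarrow> 0 \<le> poly_at h x" for h
  proof -
    \<comment> \<open>The defect sequence is again nonnegative on squares and dominated by \<open>\<mu>\<close>.\<close>
    define y where "y \<alpha> = moments_on UNIV \<alpha> - (\<Sum>i\<in>I. Y i \<alpha>)" for \<alpha>
    have y: "riesz y h = (LINT x|\<mu>. poly_at h x) - (\<Sum>i\<in>I. riesz (Y i) h)" for h
      unfolding y_def
      by (simp add: riesz_diff_seq riesz_sum_seq riesz_moments_on set_lebesgue_integral_def)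
    have "sup_bound mass y"
      by (rule sup_bound_dominated) (use dom sq in \<open>auto simp: y sum_nonneg simp del: poly_at_mult\<close>)
    then have "0 \<le> riesz y h"
      by (rule riesz_nonneg_of_squares) (use dom h in \<open>auto simp: y simp del: poly_at_mult\<close>)
    then show ?thesis by (simp add: y)
  qed
  define S where "S u = (\<Sum>i\<in>I. T i u)" for u
  have ext: "extends (\<Sum>i\<in>I. mass) (\<lambda>\<alpha>. \<Sum>i\<in>I. Y i \<alpha>) S"
    unfolding S_def by (rule extends_sum) (rule T)
  have S: "positive_functional S"
    by (rule extends_positive_functional[OF ext]) (auto simp: riesz_sum_seq intro!: sum_nonneg pos)
  have S_le: "S u \<le> (LINT x:UNIV|\<mu>. u x)" if "continuous_on UNIV u" "\<And>x. x \<in> B \<Longrightarrow> 0 \<le> u x" for u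
    using extends_le_integral[OF ext _ that] le
    by (simp add: riesz_sum_seq set_lebesgue_integral_def)

  define neg where "neg i j x = max 0 (- poly_at (q i j) x)" for i j x
  define v where "v i x = (\<Sum>j\<in>J i. (neg i j x)\<^sup>2)" for i x
  define V where "V x = (\<Prod>i\<in>I. v i x)" for x
  have cneg: "continuous_on UNIV (neg i j)" for i j
    unfolding neg_def by (intro continuous_intros)
  have cv: "continuous_on UNIV (v i)" for i
    unfolding v_def by (intro continuous_intros cneg)
  have cV: "continuous_on UNIV V"
    unfolding V_def by (intro continuous_intros cv)
  have v0: "0 \<le> v i x" for i x unfolding v_def by (intro sum_nonneg) auto
  have V0: "0 \<le> V x" for x unfolding V_def by (intro prod_nonneg) (auto simp: v0)
  have "v i x = 0 \<longleftrightarrow> (\<forall>j\<in>J i. 0 \<le> poly_at (q i j) x)" if "i \<in> I" for i x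
    using fin(2)[OF that] by (auto simp: v_def sum_nonneg_eq_0_iff neg_def max_def)
  then have V_zero: "{x. V x = 0} = \<Omega>"
    using fin(1) by (auto simp: V_def prod_zero_iff \<Omega>)
  have "T i V \<le> 0" if i: "i \<in> I" for i
  proof -
    \<comment> \<open>The factors of \<open>V\<close> other than the one that belongs to \<open>i\<close> serve as weight.\<close>
    define w where "w x = (\<Prod>k\<in>I - {i}. v k x)" for x
    have cw: "continuous_on UNIV w" unfolding w_def by (intro continuous_intros cv)
    have w0: "0 \<le> w x" for x unfolding w_def by (intro prod_nonneg) (auto simp: v0)
    have Ti: "positive_functional (T i)"
      by (rule extends_positive_functional[OF T[OF i]]) (rule pos[OF i])
    have Vw: "V = (\<lambda>x. \<Sum>j\<in>J i. (neg i j x)\<^sup>2 * w x)"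
      using fin(1) i by (auto simp: V_def w_def v_def prod.remove sum_distrib_right)
    have "T i (\<lambda>x. (neg i j x)\<^sup>2 * w x) \<le> 0" if j: "j \<in> J i" for j
    proof -
      have "0 \<le> T i (\<lambda>x. poly_at (q i j) x * (neg i j x * w x))"
        by (rule extends_localized_nonneg[OF T[OF i]])
          (use w0 in \<open>auto intro!: locpos i j continuous_intros cneg cw mult_nonneg_nonneg simp: neg_def\<close>)
      also have "(\<lambda>x. poly_at (q i j) x * (neg i j x * w x)) = (\<lambda>x. 0 - (neg i j x)\<^sup>2 * w x)"
        by (auto simp: neg_def max_def power2_eq_square)
      also have "T i \<dots> = - T i (\<lambda>x. (neg i j x)\<^sup>2 * w x)"
        using positive_functional_diff[OF Ti, of "\<lambda>_. 0" "\<lambda>x. (neg i j x)\<^sup>2 * w x"]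
        by (simp add: positive_functional_zero[OF Ti] continuous_intros cneg cw)
      finally show ?thesis by simp
    qed
    then show ?thesis unfolding Vw
      by (subst positive_functional_sum[OF Ti]) (auto intro!: continuous_intros cneg cw sum_nonpos)
  qed
  then have "S V \<le> 0" unfolding S_def by (rule sum_nonpos)
  moreover have "0 \<le> S V" by (rule positive_functional_nonneg[OF S cV V0])
  ultimately have SV: "S V = 0" by simp
  show ?thesis
  proof (intro exI[of _ S] conjI allI impI S)
    show "S (poly_at h) = (\<Sum>i\<in>I. riesz (Y i) h)" for h
      using extends_poly[OF ext] by (simp add: riesz_sum_seq)
    fix u :: "real ^ 'n \<Rightarrow> real" assume u: "continuous_on UNIV u" "\<forall>x\<in>B. 0 \<le> u x"
    have "S u \<le> (LINT x:(UNIV \<inter> {x. V x = 0})|\<mu>. u x)"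
      by (rule positive_functional_vanishing[OF S _ S_le cV V0 SV u(1)]) (use u(2) in simp_all)
    then show "S u \<le> (LINT x:\<Omega>|\<mu>. u x)" by (simp add: V_zero)
  qed
qed

text \<open>Off \<open>\<Omega>\<close> the sign of \<open>f\<close> is arbitrary, so \<open>f\<close> is split into its positive and negative parts;
  the latter vanishes almost everywhere on \<open>\<Omega>\<close> and does not contribute. In the equality case
  the gap functional \<open>D\<close> is positive, is bounded by \<open>\<mu>\<close> on \<open>\<Omega>\<close>, and vanishes at the positive
  part of \<open>f\<close>, so it is confined to a null set.\<close>

lemma positive_functional_maximal:
  assumes T: "positive_functional T" and \<Omega>: "\<Omega> \<in> sets borel"
    and le: "\<And>u. continuous_on UNIV u \<Longrightarrow> (\<And>x. x \<in> B \<Longrightarrow> 0 \<le> u x) \<Longrightarrow> T u \<le> (LINT x:\<Omega>|\<mu>. u x)"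
    and f: "continuous_on UNIV f" "AE x in \<mu>. x \<in> \<Omega> \<longrightarrow> 0 < f x"
  shows "T f \<le> (LINT x:\<Omega>|\<mu>. f x)"
    and "T f = (LINT x:\<Omega>|\<mu>. f x) \<Longrightarrow> continuous_on UNIV u \<Longrightarrow> T u = (LINT x:\<Omega>|\<mu>. u x)"
proof -
  define fp where "fp x = max 0 (f x)" for x
  define fn where "fn x = max 0 (- f x)" for x
  have cfp: "continuous_on UNIV fp" and cfn: "continuous_on UNIV fn"
    unfolding fp_def fn_def by (intro continuous_intros f)+
  have "T fn \<le> (LINT x:\<Omega>|\<mu>. fn x)" by (rule le[OF cfn]) (simp add: fn_def)
  also have "\<dots> = (LINT x:\<Omega>|\<mu>. 0)"
    by (rule set_integral_cong_AE_real[OF \<Omega> cfn]) (use f(2) in \<open>auto simp: fn_def\<close>)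
  finally have "T fn \<le> 0" by simp
  moreover have "0 \<le> T fn" by (rule positive_functional_nonneg[OF T cfn]) (simp add: fn_def)
  moreover have "f = (\<lambda>x. fp x - fn x)" by (auto simp: fp_def fn_def)
  ultimately have Tfp: "T f = T fp"
    using positive_functional_diff[OF T cfp cfn] by simp
  have If: "(LINT x:\<Omega>|\<mu>. fp x) = (LINT x:\<Omega>|\<mu>. f x)"
    by (rule set_integral_cong_AE_real[OF \<Omega> cfp f(1)]) (use f(2) in \<open>auto simp: fp_def\<close>)
  show "T f \<le> (LINT x:\<Omega>|\<mu>. f x)"
    unfolding Tfp If[symmetric] by (rule le[OF cfp]) (simp add: fp_def)
  assume eq: "T f = (LINT x:\<Omega>|\<mu>. f x)" and u: "continuous_on UNIV u"
  define D where "D w = (LINT x:\<Omega>|\<mu>. w x) - T w" for w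
  have D: "positive_functional D"
    unfolding positive_functional_def D_def
    by (auto simp: positive_functional_add[OF T] le
        set_integral_add(2)[OF set_integrable_continuous[OF \<Omega>] set_integrable_continuous[OF \<Omega>]])
  have D_le: "D w \<le> (LINT x:\<Omega>|\<mu>. w x)" if "continuous_on UNIV w" "\<And>x. x \<in> B \<Longrightarrow> 0 \<le> w x" for w
    unfolding D_def using positive_functional_nonneg[OF T that] by simp
  have Dfp: "D fp = 0" using eq Tfp If by (simp add: D_def)
  have nonneg: "D w = 0" if w: "continuous_on UNIV w" "\<And>x. x \<in> B \<Longrightarrow> 0 \<le> w x" for w
  proof (rule antisym)
    have meas: "\<Omega> \<inter> {x. fp x = 0} \<in> sets borel"
      using closed_Collect_eq[OF cfp, of "\<lambda>_. 0"] \<Omega> by auto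
    have "D w \<le> (LINT x:(\<Omega> \<inter> {x. fp x = 0})|\<mu>. w x)"
      by (rule positive_functional_vanishing[OF D \<Omega> D_le cfp _ Dfp w]) (simp_all add: fp_def)
    also have "\<dots> = (LINT x:(\<Omega> \<inter> {x. fp x = 0})|\<mu>. 0)"
      by (rule set_integral_cong_AE_real[OF meas w(1)]) (use f(2) in \<open>auto simp: fp_def\<close>)
    finally show "D w \<le> 0" by simp
    show "0 \<le> D w" by (rule positive_functional_nonneg[OF D w])
  qed
  have cont: "continuous_on UNIV (\<lambda>x. max 0 (u x))" "continuous_on UNIV (\<lambda>x. max 0 (- u x))"
    by (intro continuous_intros u)+
  have "D (\<lambda>x. max 0 (u x) - max 0 (- u x)) = 0"
    unfolding positive_functional_diff[OF D cont] using cont by (simp add: nonneg)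
  also have "(\<lambda>x. max 0 (u x) - max 0 (- u x)) = u" by auto
  finally show "T u = (LINT x:\<Omega>|\<mu>. u x)" by (simp add: D_def)
qed

end

section \<open>The semidefinite relaxations\<close>

lemma exps_upto_mono: "d \<le> e \<Longrightarrow> exps_upto d \<subseteq> exps_upto e"
  by (auto simp: exps_upto_def)

lemma sdp_feasible_antimono:
  fixes z :: "nat ^ 'n::finite \<Rightarrow> real"
  assumes "d \<le> e"
  shows "sdp_feasible p m g z e \<subseteq> sdp_feasible p m g z d"
proof
  fix y assume y: "y \<in> sdp_feasible p m g z e"
  have sub: "psd_on (exps_upto a) A" if "psd_on (exps_upto b) A" "a \<le> b"
    for a b and A :: "nat ^ 'n \<Rightarrow> nat ^ 'n \<Rightarrow> real"
    using psd_on_subset[OF that(1) exps_upto_mono[OF that(2)] finite_exps_upto] .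
  show "y \<in> sdp_feasible p m g z d"
    unfolding sdp_feasible_def
  proof (intro CollectI conjI ballI)
    show "psd_on (exps_upto d) (moment_matrix (\<lambda>\<alpha>. z \<alpha> - (\<Sum>i=1..p. y i \<alpha>)))"
      by (rule sub[OF _ assms]) (use y in \<open>simp add: sdp_feasible_def\<close>)
    fix i assume i: "i \<in> {1..p}"
    show "psd_on (exps_upto d) (moment_matrix (y i))"
      by (rule sub[OF _ assms]) (use y i in \<open>simp add: sdp_feasible_def\<close>)
    fix j assume j: "j \<in> {1..m i}"
    show "psd_on (exps_upto (d - half_deg (g i j))) (localizing_matrix (g i j) (y i))"
      by (rule sub[OF _ diff_le_mono[OF assms]]) (use y i j in \<open>simp add: sdp_feasible_def\<close>)
  qed
qed

lemma split_exponent_exact: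
  assumes "k \<le> size_exp \<gamma>"
  shows "\<exists>\<alpha> \<beta>. \<gamma> = \<alpha> + \<beta> \<and> size_exp \<alpha> = k"
  using assms
proof (induction k)
  case 0
  show ?case by (intro exI[of _ 0] exI[of _ \<gamma>]) simp
next
  case (Suc k)
  then obtain \<alpha> \<beta> where \<alpha>\<beta>: "\<gamma> = \<alpha> + \<beta>" "size_exp \<alpha> = k" by auto
  then have "size_exp \<beta> \<noteq> 0" using Suc.prems by (simp add: size_exp_add)
  then obtain i where i: "\<beta> $ i \<noteq> 0" by (auto simp: size_exp_def)
  have "size_exp (axis i (1::nat)) = 1"
    by (simp add: size_exp_def axis_def)
  moreover have "\<gamma> = (\<alpha> + axis i 1) + (\<beta> - axis i 1)"
    using i \<alpha>\<beta>(1) by (auto simp: vec_eq_iff axis_def)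
  ultimately show ?case using \<alpha>\<beta>(2)
    by (intro exI[of _ "\<alpha> + axis i 1"] exI[of _ "\<beta> - axis i 1"]) (simp add: size_exp_add)
qed

text \<open>Every exponent of size at most \<open>2 * d\<close> is an entry position of the moment matrix of order
  \<open>d\<close>, so all coordinates that matter at order \<open>d\<close> are bounded on the feasible set.\<close>

lemma split_exponent:
  assumes "size_exp \<gamma> \<le> 2 * d"
  obtains \<alpha> \<beta> where "\<gamma> = \<alpha> + \<beta>" "\<alpha> \<in> exps_upto d" "\<beta> \<in> exps_upto d"
proof -
  obtain \<alpha> \<beta> where ab: "\<gamma> = \<alpha> + \<beta>" "size_exp \<alpha> = min d (size_exp \<gamma>)"
    using split_exponent_exact[of "min d (size_exp \<gamma>)" \<gamma>] by auto
  have "size_exp \<gamma> = size_exp \<alpha> + size_exp \<beta>" by (simp add: ab(1) size_exp_add)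
  with assms ab(2) have "size_exp \<alpha> \<le> d" "size_exp \<beta> \<le> d" by arith+
  then show thesis by (intro that[OF ab(1)]) (simp_all add: exps_upto_def)
qed

text \<open>The diagonals of the \<open>p\<close> moment matrices are nonnegative and sum to at most that of \<open>z\<close>.
  The bound involves \<open>d\<close> only through the choice of \<open>\<alpha>\<close> and \<open>\<beta>\<close>; with \<open>\<beta> = 0\<close> it holds for all
  \<open>d \<ge> |\<alpha>|\<close>.\<close>

lemma sdp_feasible_bound:
  assumes y: "y \<in> sdp_feasible p m g z d" and i: "i \<in> {1..p}"
    and ab: "\<alpha> \<in> exps_upto d" "\<beta> \<in> exps_upto d"
  shows "\<bar>y i (\<alpha> + \<beta>)\<bar> \<le> (z (\<alpha> + \<alpha>) + z (\<beta> + \<beta>)) / 2"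
proof -
  have psd: "psd_on (exps_upto d) (moment_matrix (y k))" if "k \<in> {1..p}" for k
    using y that by (auto simp: sdp_feasible_def)
  have diag: "y i (\<gamma> + \<gamma>) \<le> z (\<gamma> + \<gamma>)" if \<gamma>: "\<gamma> \<in> exps_upto d" for \<gamma>
  proof -
    have "0 \<le> y k (\<gamma> + \<gamma>)" if "k \<in> {1..p}" for k
      using psd_on_diag[OF psd[OF that] \<gamma> finite_exps_upto] by (simp add: moment_matrix_def)
    then have "y i (\<gamma> + \<gamma>) \<le> (\<Sum>k=1..p. y k (\<gamma> + \<gamma>))"
      using member_le_sum[of i "{1..p}" "\<lambda>k. y k (\<gamma> + \<gamma>)"] i by auto
    moreover have "psd_on (exps_upto d) (moment_matrix (\<lambda>\<alpha>. z \<alpha> - (\<Sum>k=1..p. y k \<alpha>)))"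
      using y by (simp add: sdp_feasible_def)
    from psd_on_diag[OF this \<gamma> finite_exps_upto]
    have "(\<Sum>k=1..p. y k (\<gamma> + \<gamma>)) \<le> z (\<gamma> + \<gamma>)" by (simp add: moment_matrix_def)
    ultimately show ?thesis by simp
  qed
  show ?thesis
    using psd_on_entry_bound[OF psd[OF i] ab finite_exps_upto] diag[OF ab(1)] diag[OF ab(2)]
    by (simp add: moment_matrix_def)
qed

lemma riesz_tendsto:
  assumes "\<And>\<gamma>. \<gamma> \<in> Poly_Mapping.keys h \<Longrightarrow> (\<lambda>k. y k \<gamma>) \<longlonglongrightarrow> Y \<gamma>"
  shows "(\<lambda>k. riesz (y k) h) \<longlonglongrightarrow> riesz Y h"
  unfolding riesz_def by (intro tendsto_sum tendsto_mult tendsto_const assms)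

lemma half_deg_le_min_order:
  "half_deg f \<le> min_order p m g f"
  "i \<in> {1..p} \<Longrightarrow> j \<in> {1..m i} \<Longrightarrow> half_deg (g i j) \<le> min_order p m g f"
proof -
  have "{half_deg (g i j) |i j. i \<in> {1..p} \<and> j \<in> {1..m i}}
      = (\<lambda>(i, j). half_deg (g i j)) ` (SIGMA i:{1..p}. {1..m i})" by force
  then have "finite {half_deg (g i j) |i j. i \<in> {1..p} \<and> j \<in> {1..m i}}"
    by (simp only: finite_imageI finite_SigmaI finite_atLeastAtMost)
  then have fin: "finite (insert (half_deg f) {half_deg (g i j) |i j. i \<in> {1..p} \<and> j \<in> {1..m i}})"
    by simp
  show "half_deg f \<le> min_order p m g f"
    unfolding min_order_def by (rule Max_ge[OF fin]) simp
  show "half_deg (g i j) \<le> min_order p m g f" if "i \<in> {1..p}" "j \<in> {1..m i}" for i j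
    unfolding min_order_def
  proof (rule Max_ge[OF fin], rule insertI2)
    show "half_deg (g i j) \<in> {half_deg (g i j) |i j. i \<in> {1..p} \<and> j \<in> {1..m i}}"
      using that by (intro CollectI exI[of _ i] exI[of _ j]) simp
  qed
qed

text \<open>Convergence is required only at exponents of size at most \<open>2 * d\<close>: since
  \<open>d\<close> is at least the half degree of each \<open>g i j\<close>, the localizing matrices involve no others.\<close>

lemma sdp_feasible_limit:
  fixes z :: "nat ^ 'n::finite \<Rightarrow> real"
  assumes d: "min_order p m g f \<le> d"
    and y: "\<forall>\<^sub>F k in sequentially. y k \<in> sdp_feasible p m g z d"
    and lim: "\<And>i \<gamma>. i \<in> {1..p} \<Longrightarrow> size_exp \<gamma> \<le> 2 * d \<Longrightarrow> (\<lambda>k. y k i \<gamma>) \<longlonglongrightarrow> Y i \<gamma>"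
  shows "Y \<in> sdp_feasible p m g z d"
  unfolding sdp_feasible_def
proof (intro CollectI conjI ballI)
  have size: "size_exp (a + b) \<le> 2 * c" if "a \<in> exps_upto c" "b \<in> exps_upto c" for a b :: "nat ^ 'n" and c
    using that by (simp add: exps_upto_def size_exp_add)
  show "psd_on (exps_upto d) (moment_matrix (\<lambda>\<alpha>. z \<alpha> - (\<Sum>i=1..p. Y i \<alpha>)))"
  proof (rule psd_on_limit)
    show "\<forall>\<^sub>F k in sequentially. psd_on (exps_upto d) (moment_matrix (\<lambda>\<alpha>. z \<alpha> - (\<Sum>i=1..p. y k i \<alpha>)))"
      using y by eventually_elim (simp add: sdp_feasible_def)
  qed (auto simp: moment_matrix_def intro!: tendsto_intros lim size)
  show "psd_on (exps_upto d) (moment_matrix (Y i))" if i: "i \<in> {1..p}" for i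
  proof (rule psd_on_limit)
    show "\<forall>\<^sub>F k in sequentially. psd_on (exps_upto d) (moment_matrix (y k i))"
      using y by eventually_elim (use i in \<open>auto simp: sdp_feasible_def\<close>)
  qed (use i in \<open>auto simp: moment_matrix_def intro!: lim size\<close>)
  show "psd_on (exps_upto (d - half_deg (g i j))) (localizing_matrix (g i j) (Y i))"
    if i: "i \<in> {1..p}" and j: "j \<in> {1..m i}" for i j
  proof (rule psd_on_limit)
    show "\<forall>\<^sub>F k in sequentially.
        psd_on (exps_upto (d - half_deg (g i j))) (localizing_matrix (g i j) (y k i))"
      using y by eventually_elim (use i j in \<open>auto simp: sdp_feasible_def\<close>)
    fix a b :: "nat ^ 'n" assume ab: "a \<in> exps_upto (d - half_deg (g i j))" "b \<in> exps_upto (d - half_deg (g i j))"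
    have hd: "half_deg (g i j) \<le> d" using half_deg_le_min_order(2)[of i p j m g f] i j d by simp
    show "(\<lambda>k. localizing_matrix (g i j) (y k i) a b) \<longlonglongrightarrow> localizing_matrix (g i j) (Y i) a b"
      unfolding localizing_matrix_def
    proof (intro riesz_tendsto lim i)
      fix \<gamma> assume "\<gamma> \<in> Poly_Mapping.keys (g i j * Poly_Mapping.single (a + b) 1)"
      then obtain c where c: "c \<in> Poly_Mapping.keys (g i j)" "\<gamma> = c + (a + b)"
        using keys_mult[of "g i j" "Poly_Mapping.single (a + b) 1"] by (auto split: if_splits)
      have "size_exp c \<le> 2 * half_deg (g i j)"
        using size_exp_le_total_deg[OF c(1)] total_deg_le_half_deg order_trans by blast
      with size[OF ab] hd show "size_exp \<gamma> \<le> 2 * d"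
        by (simp add: c(2) size_exp_add)
    qed
  qed
qed

lemma sdp_objective_tendsto:
  assumes "min_order p m g f \<le> d"
    and "\<And>i \<gamma>. i \<in> {1..p} \<Longrightarrow> size_exp \<gamma> \<le> 2 * d \<Longrightarrow> (\<lambda>k. y k i \<gamma>) \<longlonglongrightarrow> Y i \<gamma>"
  shows "(\<lambda>k. sdp_objective p f (y k)) \<longlonglongrightarrow> sdp_objective p f Y"
  unfolding sdp_objective_def
proof (intro tendsto_sum riesz_tendsto assms(2))
  fix \<gamma> assume "\<gamma> \<in> Poly_Mapping.keys f"
  then have "size_exp \<gamma> \<le> 2 * half_deg f"
    using size_exp_le_total_deg total_deg_le_half_deg order_trans by blast
  then show "size_exp \<gamma> \<le> 2 * d"
    using half_deg_le_min_order(1)[of f p m g] assms(1) by linarith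
qed

text \<open>Diagonal extraction with a bound that depends on the coordinate; it reduces to a uniformly
  bounded sequence by truncating and rescaling each coordinate.\<close>

lemma pointwise_convergent_subsequence:
  fixes x :: "nat \<Rightarrow> 'a::countable \<Rightarrow> real"
  assumes "\<And>s. s \<in> S \<Longrightarrow> \<exists>c. \<forall>\<^sub>F k in sequentially. \<bar>x k s\<bar> \<le> c"
  shows "\<exists>r l. strict_mono (r :: nat \<Rightarrow> nat) \<and> (\<forall>s\<in>S. (\<lambda>k. x (r k) s) \<longlonglongrightarrow> l s)"
proof -
  obtain c where c: "\<And>s. s \<in> S \<Longrightarrow> \<forall>\<^sub>F k in sequentially. \<bar>x k s\<bar> \<le> c s"
    using assms by metis
  define f where "f k s = (if \<bar>x k s\<bar> \<le> c s then x k s / (1 + \<bar>c s\<bar>) else 0)" for k s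
  have f1: "norm (f k s) \<le> 1" for k s
    by (auto simp: f_def divide_le_eq)
  obtain r where r: "strict_mono (r :: nat \<Rightarrow> nat)" "\<And>s. s \<in> S \<Longrightarrow> \<exists>l. (\<lambda>k. f (r k) s) \<longlonglongrightarrow> l"
    by (rule function_convergent_subsequence[of S f 1, OF countableI_type f1]) blast
  then obtain l where l: "\<And>s. s \<in> S \<Longrightarrow> (\<lambda>k. f (r k) s) \<longlonglongrightarrow> l s" by metis
  show ?thesis
  proof (intro exI conjI ballI)
    show "strict_mono r" by (rule r(1))
    fix s assume s: "s \<in> S"
    have "\<forall>\<^sub>F k in sequentially. f (r k) s * (1 + \<bar>c s\<bar>) = x (r k) s"
      using eventually_subseq[OF r(1) c[OF s]]
    proof eventually_elim
      case (elim k)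
      have "1 + \<bar>c s\<bar> \<noteq> 0" by linarith
      with elim show ?case by (simp add: f_def)
    qed
    with tendsto_mult_right[OF l[OF s]]
    show "(\<lambda>k. x (r k) s) \<longlonglongrightarrow> l s * (1 + \<bar>c s\<bar>)"
      by (rule Lim_transform_eventually)
  qed
qed

lemma sdp_value_optimal:
  assumes "sdp_optimal p m g z f d y"
  shows "sdp_value p m g z f d = ereal (sdp_objective p f y)"
  unfolding sdp_value_def
proof (rule antisym)
  show "(SUP y\<in>sdp_feasible p m g z d. ereal (sdp_objective p f y)) \<le> ereal (sdp_objective p f y)"
    by (rule SUP_least) (use assms in \<open>auto simp: sdp_optimal_def\<close>)
  show "ereal (sdp_objective p f y) \<le> (SUP y\<in>sdp_feasible p m g z d. ereal (sdp_objective p f y))"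
    by (rule SUP_upper) (use assms in \<open>auto simp: sdp_optimal_def\<close>)
qed

text \<open>The supremum is approached along a sequence of feasible points; the coordinates up to size
  \<open>2 * d\<close> are bounded, so a subsequence converges there to a feasible point, and its objective
  value is the supremum. In particular the supremum is finite.\<close>

lemma sdp_optimal_exists:
  fixes z :: "nat ^ 'n::finite \<Rightarrow> real"
  assumes d: "min_order p m g f \<le> d" and ne: "sdp_feasible p m g z d \<noteq> {}"
  shows "\<exists>y. sdp_optimal p m g z f d y"
proof -
  let ?F = "sdp_feasible p m g z d" and ?obj = "sdp_objective p f"
  obtain o' :: "nat \<Rightarrow> ereal" where o': "range o' \<subseteq> (\<lambda>y. ereal (?obj y)) ` ?F"
      "sdp_value p m g z f d = (SUP k. o' k)" "incseq o'"
    using Sup_countable_SUP[of "(\<lambda>y. ereal (?obj y)) ` ?F"] ne unfolding sdp_value_def by auto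
  have "\<exists>y. y \<in> ?F \<and> o' k = ereal (?obj y)" for k using o'(1) by blast
  then obtain y where y: "\<And>k. y k \<in> ?F" "\<And>k. o' k = ereal (?obj (y k))" by metis
  define S where "S = {1..p} \<times> (exps_upto (2 * d) :: (nat ^ 'n) set)"
  have bnd: "\<exists>c. \<forall>\<^sub>F k in sequentially. \<bar>case s of (i, \<gamma>) \<Rightarrow> y k i \<gamma>\<bar> \<le> c" if "s \<in> S" for s
  proof -
    obtain i \<gamma> where s': "s = (i, \<gamma>)" by (cases s)
    with that have s: "s = (i, \<gamma>)" "i \<in> {1..p}" "size_exp \<gamma> \<le> 2 * d"
      by (auto simp: S_def exps_upto_def)
    obtain \<alpha> \<beta> where ab: "\<gamma> = \<alpha> + \<beta>" "\<alpha> \<in> exps_upto d" "\<beta> \<in> exps_upto d"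
      using split_exponent[OF s(3)] .
    have "\<bar>y k i \<gamma>\<bar> \<le> (z (\<alpha> + \<alpha>) + z (\<beta> + \<beta>)) / 2" for k
      unfolding ab(1) by (rule sdp_feasible_bound[OF y(1) s(2) ab(2,3)])
    then show ?thesis
      unfolding s(1) prod.case by (intro exI[of _ "(z (\<alpha> + \<alpha>) + z (\<beta> + \<beta>)) / 2"]) (simp only: eventually_True)
  qed
  have "\<exists>r l. strict_mono (r :: nat \<Rightarrow> nat) \<and>
      (\<forall>s\<in>S. (\<lambda>k. case s of (i, \<gamma>) \<Rightarrow> y (r k) i \<gamma>) \<longlonglongrightarrow> l s)"
    by (rule pointwise_convergent_subsequence) (rule bnd)
  then obtain r l where r: "strict_mono (r :: nat \<Rightarrow> nat)"
    and l: "\<forall>s\<in>S. (\<lambda>k. case s of (i, \<gamma>) \<Rightarrow> y (r k) i \<gamma>) \<longlonglongrightarrow> l s"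
    by (elim exE conjE)
  define Y where "Y i \<gamma> = l (i, \<gamma>)" for i \<gamma>
  have lim: "(\<lambda>k. y (r k) i \<gamma>) \<longlonglongrightarrow> Y i \<gamma>" if "i \<in> {1..p}" "size_exp \<gamma> \<le> 2 * d" for i \<gamma>
    using bspec[OF l, of "(i, \<gamma>)"] that by (simp add: S_def Y_def exps_upto_def)
  have Y: "Y \<in> ?F" by (rule sdp_feasible_limit[OF d _ lim]) (auto simp: y)
  have "o' \<longlonglongrightarrow> sdp_value p m g z f d" unfolding o'(2) by (rule LIMSEQ_SUP[OF o'(3)])
  then have "(\<lambda>k. o' (r k)) \<longlonglongrightarrow> sdp_value p m g z f d"
    using LIMSEQ_subseq_LIMSEQ[OF _ r] by (simp add: o_def)
  moreover have "(\<lambda>k. o' (r k)) \<longlonglongrightarrow> ereal (?obj Y)"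
    unfolding y(2) using sdp_objective_tendsto[OF d lim] by simp
  ultimately have "sdp_value p m g z f d = ereal (?obj Y)" by (rule LIMSEQ_unique)
  then have "?obj y' \<le> ?obj Y" if "y' \<in> ?F" for y'
    using SUP_upper[OF that, of "\<lambda>y. ereal (?obj y)"] by (simp add: sdp_value_def)
  with Y show ?thesis unfolding sdp_optimal_def by blast
qed


section \<open>Feasible points from measures\<close>

lemma semialg_closed: "closed (semialg k h)"
proof -
  have "semialg k h = (\<Inter>j\<in>{1..k}. {x. 0 \<le> poly_at (h j) x})"
    by (auto simp: semialg_def)
  then show ?thesis
    by (simp only:) (intro closed_INT ballI closed_Collect_le continuous_intros)
qed

lemma disjoint_refinement:
  fixes W :: "nat \<Rightarrow> 'a::topological_space set"
  assumes "\<And>i. W i \<in> sets borel"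
  obtains D where "\<And>i. D i \<in> sets borel" "\<And>i. D i \<subseteq> W i" "disjoint_family D"
    "(\<Union>i\<in>{1..p}. D i) = (\<Union>i\<in>{1..p}. W i)"
proof -
  define A where "A i = (if i \<in> {1..p} then W i else {})" for i
  have A: "range A \<subseteq> sets borel" using assms by (auto simp: A_def)
  have sub: "disjointed A i \<subseteq> A i" for i by (rule disjointed_subset)
  have "(\<Union>i\<in>{1..p}. disjointed A i) = (\<Union>i. disjointed A i)"
    using sub by (fastforce simp: A_def split: if_splits)
  also have "\<dots> = (\<Union>i. A i)" by (rule UN_disjointed_eq)
  also have "\<dots> = (\<Union>i\<in>{1..p}. W i)" by (auto simp: A_def split: if_splits)
  finally have un: "(\<Union>i\<in>{1..p}. disjointed A i) = (\<Union>i\<in>{1..p}. W i)" .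
  show thesis
  proof (rule that[OF _ _ _ un])
    show "disjointed A i \<in> sets borel" for i
      using sets.range_disjointed_sets[OF A] by blast
    show "disjointed A i \<subseteq> W i" for i using sub[of i] by (auto simp: A_def split: if_splits)
  qed (rule disjoint_family_disjointed)
qed

context compact_measure
begin

lemma sum_set_integral_disjoint:
  fixes u :: "real ^ 'n \<Rightarrow> real"
  assumes "finite I" "disjoint_family D" "\<And>i. D i \<in> sets borel" "continuous_on UNIV u"
  shows "(\<Sum>i\<in>I. LINT x:D i|\<mu>. u x) = (LINT x:(\<Union>i\<in>I. D i)|\<mu>. u x)"
proof (rule set_integral_finite_Union[symmetric])
  show "disjoint_family_on D I" using assms(2) by (auto simp: disjoint_family_on_def)
qed (use assms in \<open>auto simp: sets_\<mu> intro: set_integrable_continuous\<close>)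

text \<open>The quadratic forms of the three kinds of matrices are integrals of \<open>h\<^sup>2\<close> over the complement
  of the pieces, of \<open>h\<^sup>2\<close> over a piece, and of \<open>g h\<^sup>2\<close> over a piece on which \<open>g \<ge> 0\<close>.\<close>

lemma sdp_feasible_moments_on:
  assumes D: "\<And>i. D i \<in> sets borel" "\<And>i. D i \<subseteq> semialg (m i) (g i)" "disjoint_family D"
  shows "(\<lambda>i. moments_on (D i)) \<in> sdp_feasible p m g (moments \<mu>) d"
proof -
  let ?U = "\<Union>i\<in>{1..p}. D i"
  have "0 \<le> riesz (\<lambda>\<alpha>. moments \<mu> \<alpha> - (\<Sum>i=1..p. moments_on (D i) \<alpha>)) (h * h)" for h
  proof -
    have "(\<Sum>i=1..p. riesz (moments_on (D i)) (h * h)) = (LINT x:?U|\<mu>. poly_at (h * h) x)"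
      by (simp only: riesz_moments_on D(1))
        (rule sum_set_integral_disjoint, use D in \<open>auto intro: continuous_poly_at simp del: poly_at_mult\<close>)
    also have "\<dots> \<le> (LINT x|\<mu>. poly_at (h * h) x)"
      unfolding set_lebesgue_integral_def
    proof (rule integral_mono)
      show "integrable \<mu> (\<lambda>x. indicator ?U x *\<^sub>R poly_at (h * h) x)"
        using set_integrable_continuous[OF _ continuous_poly_at] D(1)
        unfolding set_integrable_def by blast
      show "integrable \<mu> (poly_at (h * h))"
        by (rule integrable_continuous[OF continuous_poly_at])
    qed (auto simp: indicator_def)
    finally show ?thesis
      by (simp add: riesz_diff_seq riesz_sum_seq set_lebesgue_integral_def
          riesz_moments_on[of UNIV] flip: moments_on_UNIV)
  qed
  moreover have "0 \<le> riesz (localized (g i j) (moments_on (D i))) (h * h)" if "j \<in> {1..m i}" for i j h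
    unfolding riesz_localized riesz_moments_on[OF D(1)] set_lebesgue_integral_def
    using D(2)[of i] that by (intro Bochner_Integration.integral_nonneg) (auto simp: semialg_def indicator_def)
  moreover have "0 \<le> riesz (moments_on (D i)) (h * h)" for i h
    by (rule riesz_moments_square_nonneg[OF D(1)])
  ultimately show ?thesis
    unfolding sdp_feasible_def localizing_matrix_localized
    by (intro CollectI conjI ballI psd_moment_riesz_iff[THEN iffD2, rule_format]) blast+
qed

lemma sdp_objective_moments_on:
  assumes "\<And>i. D i \<in> sets borel" "disjoint_family D"
  shows "sdp_objective p f (\<lambda>i. moments_on (D i)) = (LINT x:(\<Union>i\<in>{1..p}. D i)|\<mu>. poly_at f x)"
  unfolding sdp_objective_def riesz_moments_on[OF assms(1)]
  by (rule sum_set_integral_disjoint) (use assms continuous_poly_at in auto)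

end

section \<open>The linear program on measures\<close>

lemma sum_nn_integral_le:
  fixes \<mu> :: "'a::topological_space measure"
  assumes fin: "finite I"
    and \<mu>: "sets \<mu> = sets borel" and \<phi>: "\<And>i. i \<in> I \<Longrightarrow> sets (\<phi> i) = sets borel"
    and le: "\<And>C. C \<in> sets borel \<Longrightarrow> (\<Sum>i\<in>I. emeasure (\<phi> i) C) \<le> emeasure \<mu> C"
    and h: "h \<in> borel_measurable borel"
  shows "(\<Sum>i\<in>I. \<integral>\<^sup>+x. h x \<partial>\<phi> i) \<le> (\<integral>\<^sup>+x. h x \<partial>\<mu>)"
  using h
proof (induction rule: borel_measurable_induct)
  case (cong f g)
  then show ?case by (simp add: fun_eq_iff[symmetric] cong: nn_integral_cong)
next
  case (set A)
  then show ?case using le[of A] \<mu> \<phi> by simp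
next
  case (mult u c)
  have m: "u \<in> borel_measurable (\<phi> i)" if "i \<in> I" for i
    using mult measurable_cong_sets[OF \<phi>[OF that] refl] by blast
  have m': "u \<in> borel_measurable \<mu>"
    using mult measurable_cong_sets[OF \<mu> refl] by blast
  have "(\<Sum>i\<in>I. \<integral>\<^sup>+x. c * u x \<partial>\<phi> i) = c * (\<Sum>i\<in>I. \<integral>\<^sup>+x. u x \<partial>\<phi> i)"
    using m by (simp add: nn_integral_cmult sum_distrib_left)
  then show ?case using mult m' by (simp add: nn_integral_cmult mult_left_mono)
next
  case (add u v)
  have m: "u \<in> borel_measurable (\<phi> i)" "v \<in> borel_measurable (\<phi> i)" if "i \<in> I" for i
    using add measurable_cong_sets[OF \<phi>[OF that] refl] by blast+
  have m': "u \<in> borel_measurable \<mu>" "v \<in> borel_measurable \<mu>"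
    using add measurable_cong_sets[OF \<mu> refl] by blast+
  have "(\<Sum>i\<in>I. \<integral>\<^sup>+x. v x + u x \<partial>\<phi> i) = (\<Sum>i\<in>I. \<integral>\<^sup>+x. v x \<partial>\<phi> i) + (\<Sum>i\<in>I. \<integral>\<^sup>+x. u x \<partial>\<phi> i)"
    using m by (simp add: nn_integral_add sum.distrib)
  then show ?case using add m' by (simp add: nn_integral_add add_mono)
next
  case (seq U)
  have m: "U k \<in> borel_measurable (\<phi> i)" if "i \<in> I" for i k
    using seq measurable_cong_sets[OF \<phi>[OF that] refl] by blast
  have m': "U k \<in> borel_measurable \<mu>" for k
    using seq measurable_cong_sets[OF \<mu> refl] by blast
  have lim: "(\<lambda>k. \<integral>\<^sup>+x. U k x \<partial>M) \<longlonglongrightarrow> (\<integral>\<^sup>+x. (SUP k. U k) x \<partial>M)"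
    if "\<And>k. U k \<in> borel_measurable M" for M
  proof -
    have "incseq (\<lambda>k. \<integral>\<^sup>+x. U k x \<partial>M)"
      using seq(3) by (auto simp: incseq_def le_fun_def intro!: nn_integral_mono)
    moreover have "(\<integral>\<^sup>+x. (SUP k. U k) x \<partial>M) = (SUP k. \<integral>\<^sup>+x. U k x \<partial>M)"
      using nn_integral_monotone_convergence_SUP[OF seq(3) that] by (simp add: SUP_apply image_comp)
    ultimately show ?thesis by (simp add: LIMSEQ_SUP)
  qed
  show ?case
    by (rule LIMSEQ_le[OF tendsto_sum[OF lim[OF m]] lim[OF m']]) (use seq in auto)
qed

text \<open>The positive part of \<open>f\<close>, restricted to \<open>\<Omega>\<close>, dominates each integrand and has the same
  \<open>\<mu>\<close>-integral as \<open>f\<close> on \<open>\<Omega>\<close>; this gives the upper bound. Restricting \<open>\<mu>\<close> to disjoint pieces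
  of \<open>\<Omega>\<close> attains it.\<close>

lemma measure_lp_value_eq:
  fixes \<mu> :: "(real ^ 'n::finite) measure"
  assumes \<mu>: "compact_measure B \<mu>"
    and W: "\<And>i. W i = semialg (m i) (g i)" and \<Omega>: "\<Omega> = (\<Union>i\<in>{1..p}. W i)" "\<Omega> \<subseteq> B"
    and f: "AE x in \<mu>. x \<in> \<Omega> \<longrightarrow> poly_at f x > 0"
  shows "measure_lp_value p W \<mu> f = ereal (LINT x:\<Omega>|\<mu>. poly_at f x)"
proof -
  interpret compact_measure B \<mu> by fact
  have W_borel: "W i \<in> sets borel" for i
    using semialg_closed[of "m i" "g i"] by (simp add: W)
  then have \<Omega>_borel: "\<Omega> \<in> sets borel" unfolding \<Omega>(1) by auto
  let ?val = "\<lambda>\<phi>. \<Sum>i=1..p. LINT x:W i|\<phi> i. poly_at f x"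
  have upper: "?val \<phi> \<le> (LINT x:\<Omega>|\<mu>. poly_at f x)" if \<phi>: "\<phi> \<in> measure_lp_feasible p W \<mu>" for \<phi>
  proof -
    define v where "v x = indicator \<Omega> x *\<^sub>R max 0 (poly_at f x)" for x
    have v0: "0 \<le> v x" for x by (simp add: v_def)
    have v_meas: "v \<in> borel_measurable borel"
      unfolding v_def using \<Omega>_borel
      by (intro borel_measurable_scaleR borel_measurable_indicator borel_measurable_continuous_onI
          continuous_intros)
    have cm: "compact_measure B (\<phi> i)" if i: "i \<in> {1..p}" for i
    proof -
      have s: "sets (\<phi> i) = sets borel" and fm: "finite_measure (\<phi> i)" and n: "emeasure (\<phi> i) (- W i) = 0"
        using \<phi> i by (auto simp: measure_lp_feasible_def finite_borel_measures_on_def)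
      have "emeasure (\<phi> i) (- B) \<le> emeasure (\<phi> i) (- W i)"
      proof (rule emeasure_mono)
        have "W i \<subseteq> B" using \<Omega> i by blast
        then show "- B \<subseteq> - W i" by blast
        show "- W i \<in> sets (\<phi> i)" using W_borel by (simp add: s)
      qed
      with n have "emeasure (\<phi> i) (- B) = 0" by simp
      with s fm compact_B show ?thesis by (intro compact_measure.intro)
    qed
    have vint: "integrable (\<phi> i) v" if "i \<in> {1..p}" for i
      using compact_measure.set_integrable_continuous[OF cm[OF that] \<Omega>_borel, of "\<lambda>x. max 0 (poly_at f x)"]
      unfolding v_def set_integrable_def by (simp add: continuous_intros)
    have vint\<mu>: "integrable \<mu> v"
      using set_integrable_continuous[OF \<Omega>_borel, of "\<lambda>x. max 0 (poly_at f x)"]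
      unfolding v_def set_integrable_def by (simp add: continuous_intros)
    have "?val \<phi> \<le> (\<Sum>i=1..p. LINT x|\<phi> i. v x)"
    proof (rule sum_mono)
      fix i assume i: "i \<in> {1..p}"
      show "(LINT x:W i|\<phi> i. poly_at f x) \<le> (LINT x|\<phi> i. v x)"
        unfolding set_lebesgue_integral_def
      proof (rule integral_mono[OF _ vint[OF i]])
        show "integrable (\<phi> i) (\<lambda>x. indicator (W i) x *\<^sub>R poly_at f x)"
          using compact_measure.set_integrable_continuous[OF cm[OF i] W_borel continuous_poly_at]
          unfolding set_integrable_def .
        show "indicator (W i) x *\<^sub>R poly_at f x \<le> v x" for x
          using i by (auto simp: v_def \<Omega>(1) indicator_def)
      qed
    qed
    also have "\<dots> \<le> (LINT x|\<mu>. v x)"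
    proof -
      have "ennreal (\<Sum>i=1..p. LINT x|\<phi> i. v x) = (\<Sum>i=1..p. \<integral>\<^sup>+x. v x \<partial>\<phi> i)"
        by (subst sum_ennreal[symmetric])
          (auto intro!: sum.cong Bochner_Integration.integral_nonneg v0 nn_integral_eq_integral[symmetric] vint)
      also have "\<dots> \<le> (\<integral>\<^sup>+x. v x \<partial>\<mu>)"
        by (rule sum_nn_integral_le)
          (use \<phi> sets_\<mu> v_meas in \<open>auto simp: measure_lp_feasible_def finite_borel_measures_on_def\<close>)
      also have "\<dots> = ennreal (LINT x|\<mu>. v x)"
        by (rule nn_integral_eq_integral[OF vint\<mu>]) (simp add: v0)
      finally show ?thesis by (simp add: Bochner_Integration.integral_nonneg v0)
    qed
    also have "(LINT x|\<mu>. v x) = (LINT x:\<Omega>|\<mu>. max 0 (poly_at f x))"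
      by (simp add: v_def set_lebesgue_integral_def)
    also have "\<dots> = (LINT x:\<Omega>|\<mu>. poly_at f x)"
      by (rule set_integral_cong_AE_real[OF \<Omega>_borel]) (use f in \<open>auto intro: continuous_intros\<close>)
    finally show ?thesis .
  qed
  obtain D where D: "\<And>i. D i \<in> sets borel" "\<And>i. D i \<subseteq> W i" "disjoint_family D"
    "(\<Union>i\<in>{1..p}. D i) = \<Omega>"
    unfolding \<Omega>(1) by (rule disjoint_refinement[of W p, OF W_borel]) blast
  define \<phi> where "\<phi> i = density \<mu> (\<lambda>x. ennreal (indicator (D i) x))" for i
  have D\<mu>: "D i \<in> sets \<mu>" for i using D(1) by (simp add: sets_\<mu>)
  have em: "emeasure (\<phi> i) C = emeasure \<mu> (D i \<inter> C)" if "C \<in> sets borel" for i C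
  proof -
    have C: "C \<in> sets \<mu>" using that by (simp add: sets_\<mu>)
    have "emeasure (\<phi> i) C = (\<integral>\<^sup>+x. ennreal (indicator (D i) x) * indicator C x \<partial>\<mu>)"
      unfolding \<phi>_def using D\<mu>[of i] C by (intro emeasure_density) simp_all
    also have "\<dots> = (\<integral>\<^sup>+x. indicator (D i \<inter> C) x \<partial>\<mu>)"
      by (intro nn_integral_cong) (auto simp: indicator_def)
    finally show ?thesis using D\<mu>[of i] C by simp
  qed
  have feas: "\<phi> \<in> measure_lp_feasible p W \<mu>"
    unfolding measure_lp_feasible_def finite_borel_measures_on_def
  proof (intro CollectI conjI ballI)
    fix C :: "(real ^ 'n) set" assume C: "C \<in> sets borel"
    have "(\<Sum>i=1..p. emeasure (\<phi> i) C) = (\<Sum>i=1..p. emeasure \<mu> (D i \<inter> C))"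
      by (simp add: em[OF C])
    also have "\<dots> = emeasure \<mu> (\<Union>i\<in>{1..p}. D i \<inter> C)"
      by (rule sum_emeasure) (use D(3) D\<mu> C in \<open>auto simp: sets_\<mu> disjoint_family_on_def\<close>)
    also have "\<dots> \<le> emeasure \<mu> C"
      by (rule emeasure_mono) (use C in \<open>auto simp: sets_\<mu>\<close>)
    finally show "(\<Sum>i=1..p. emeasure (\<phi> i) C) \<le> emeasure \<mu> C" .
  next
    fix i
    show "sets (\<phi> i) = sets borel" by (simp add: \<phi>_def sets_\<mu>)
    show "finite_measure (\<phi> i)"
      by (rule finite_measureI) (use em[of UNIV i] in \<open>simp add: \<phi>_def\<close>)
    have "D i \<inter> - W i = {}" using D(2)[of i] by auto
    then show "emeasure (\<phi> i) (- W i) = 0" using em[of "- W i" i] W_borel[of i] by simp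
  qed
  have val: "?val \<phi> = (LINT x:\<Omega>|\<mu>. poly_at f x)"
  proof -
    have "(LINT x:W i|\<phi> i. poly_at f x) = (LINT x:D i|\<mu>. poly_at f x)" for i
    proof -
      have "(LINT x:W i|\<phi> i. poly_at f x)
          = (LINT x|\<mu>. indicator (D i) x *\<^sub>R (indicator (W i) x *\<^sub>R poly_at f x))"
        unfolding \<phi>_def set_lebesgue_integral_def
        by (rule integral_density)
          (use D\<mu>[of i] W_borel[of i] measurable_continuous[OF continuous_poly_at]
            in \<open>auto simp: sets_\<mu> intro!: borel_measurable_times borel_measurable_indicator\<close>)
      also have "\<dots> = (LINT x:D i|\<mu>. poly_at f x)"
        unfolding set_lebesgue_integral_def
        by (rule Bochner_Integration.integral_cong) (use D(2)[of i] in \<open>auto simp: indicator_def\<close>)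
      finally show ?thesis .
    qed
    then show ?thesis
      using sum_set_integral_disjoint[OF _ D(3,1) continuous_poly_at, of "{1..p}" f]
      unfolding D(4) by simp
  qed
  have "ereal (LINT x:\<Omega>|\<mu>. poly_at f x) \<le> measure_lp_value p W \<mu> f"
    unfolding measure_lp_value_def val[symmetric] by (rule SUP_upper[OF feas])
  moreover have "measure_lp_value p W \<mu> f \<le> ereal (LINT x:\<Omega>|\<mu>. poly_at f x)"
    unfolding measure_lp_value_def by (rule SUP_least) (use upper in simp)
  ultimately show ?thesis by (rule antisym[rotated])
qed

section \<open>Convergence of the relaxations\<close>

text \<open>The complement of the support is the union of the open null sets, which by the Lindelof
  property is a countable union of such sets.\<close>

lemma emeasure_outside_support:
  fixes M :: "'a::second_countable_topology measure"
  assumes "sets M = sets borel"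
  shows "emeasure M (- measure_support M) = 0"
proof -
  define F where "F = {U. open U \<and> emeasure M U = 0}"
  have "\<Union>F = - measure_support M"
    by (auto simp: F_def measure_support_def zero_less_iff_neq_zero)
  moreover obtain F' where F': "F' \<subseteq> F" "countable F'" "\<Union>F' = \<Union>F"
    using Lindelof[of F] by (auto simp: F_def)
  have "(\<Union>U\<in>F'. U) \<in> null_sets M"
    by (rule null_sets_UN'[OF F'(2)]) (use F'(1) assms in \<open>auto simp: F_def null_sets_def\<close>)
  ultimately show ?thesis using F'(3) by (auto simp: null_sets_def)
qed

context compact_measure
begin

text \<open>A sequence that is feasible at every order and whose objective is at least \<open>\<integral>\<^sub>\<Omega> f d\<mu>\<close> is in the
  equality case of \<open>positive_functional_maximal\<close>.\<close>

lemma sdp_limit_moments: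
  assumes d0: "d0 = min_order p m g f"
    and W: "\<And>i. W i = semialg (m i) (g i)" and \<Omega>: "\<Omega> = (\<Union>i\<in>{1..p}. W i)"
    and f: "AE x in \<mu>. x \<in> \<Omega> \<longrightarrow> poly_at f x > 0"
    and Y: "\<And>d. d0 \<le> d \<Longrightarrow> Y \<in> sdp_feasible p m g (moments \<mu>) d"
    and obj: "(LINT x:\<Omega>|\<mu>. poly_at f x) \<le> sdp_objective p f Y"
  shows "(\<Sum>i=1..p. Y i \<alpha>) = (LINT x:\<Omega>|\<mu>. monom_at \<alpha> x)"
proof -
  have Y_all: "Y \<in> sdp_feasible p m g (moments \<mu>) d" for d
    using Y[of "max d d0"] sdp_feasible_antimono[of d "max d d0"] by fastforce
  have "W i \<in> sets borel" for i
    using semialg_closed[of "m i" "g i"] by (simp add: W)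
  then have \<Omega>_borel: "\<Omega> \<in> sets borel" unfolding \<Omega> by auto
  have "\<forall>h. 0 \<le> riesz (\<lambda>\<alpha>. moments \<mu> \<alpha> - (\<Sum>i=1..p. Y i \<alpha>)) (h * h)"
    using Y_all by (subst psd_moment_riesz_iff[symmetric]) (simp add: sdp_feasible_def)
  then have dom: "(\<Sum>i=1..p. riesz (Y i) (h * h)) \<le> (LINT x|\<mu>. poly_at (h * h) x)" for h
    by (simp add: riesz_diff_seq riesz_sum_seq riesz_moments_on[of UNIV] set_lebesgue_integral_def
        flip: moments_on_UNIV)
  have sq: "\<forall>h. 0 \<le> riesz (Y i) (h * h)" if "i \<in> {1..p}" for i
    using Y_all that by (subst psd_moment_riesz_iff[symmetric]) (simp add: sdp_feasible_def)
  have loc: "\<forall>h. 0 \<le> riesz (localized (g i j) (Y i)) (h * h)" if "i \<in> {1..p}" "j \<in> {1..m i}" for i j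
  proof -
    have "psd_on (exps_upto d) (moment_matrix (localized (g i j) (Y i)))" for d
      using Y_all[of "d + half_deg (g i j)"] that
      by (auto simp: sdp_feasible_def localizing_matrix_localized dest!: bspec)
    then show ?thesis by (subst psd_moment_riesz_iff[symmetric]) simp
  qed
  have "\<Omega> = (\<Union>i\<in>{1..p}. {x. \<forall>j\<in>{1..m i}. 0 \<le> poly_at (g i j) x})"
    by (simp add: \<Omega> W semialg_def)
  then have "\<exists>T. positive_functional T \<and> (\<forall>h. T (poly_at h) = (\<Sum>i=1..p. riesz (Y i) h)) \<and>
      (\<forall>u. continuous_on UNIV u \<longrightarrow> (\<forall>x\<in>B. 0 \<le> u x) \<longrightarrow> T u \<le> (LINT x:\<Omega>|\<mu>. u x))"
    by (intro positive_functional_of_moments[of "{1..p}" "\<lambda>i. {1..m i}" Y g \<Omega>]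
        finite_atLeastAtMost sq[rule_format] loc[rule_format] dom)
  then obtain T where T: "positive_functional T" "\<And>h. T (poly_at h) = (\<Sum>i=1..p. riesz (Y i) h)"
    and T_le: "\<forall>u. continuous_on UNIV u \<longrightarrow> (\<forall>x\<in>B. 0 \<le> u x) \<longrightarrow> T u \<le> (LINT x:\<Omega>|\<mu>. u x)"
    by blast
  have T3: "T u \<le> (LINT x:\<Omega>|\<mu>. u x)" if "continuous_on UNIV u" "\<And>x. x \<in> B \<Longrightarrow> 0 \<le> u x" for u
    using T_le that by blast
  have "T (poly_at f) \<le> (LINT x:\<Omega>|\<mu>. poly_at f x)"
    by (rule positive_functional_maximal(1)[OF T(1) \<Omega>_borel _ continuous_poly_at f]) (rule T3)
  with obj have eq: "T (poly_at f) = (LINT x:\<Omega>|\<mu>. poly_at f x)"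
    unfolding T(2) sdp_objective_def by (intro antisym)
  have "T (poly_at (Poly_Mapping.single \<alpha> 1))
      = (LINT x:\<Omega>|\<mu>. poly_at (Poly_Mapping.single \<alpha> 1) x)"
    by (rule positive_functional_maximal(2)[OF T(1) \<Omega>_borel _ continuous_poly_at f eq continuous_poly_at])
      (rule T3)
  then show ?thesis unfolding T(2) by simp
qed

text \<open>If convergence failed, some subsequence would keep a fixed distance from the claimed limit;
  by compactness a further subsequence converges, and its limit is determined by
  \<open>sdp_limit_moments\<close>.\<close>

lemma sdp_moments_tendsto:
  assumes d0: "d0 = min_order p m g f"
    and W: "\<And>i. W i = semialg (m i) (g i)" and \<Omega>: "\<Omega> = (\<Union>i\<in>{1..p}. W i)"
    and f: "AE x in \<mu>. x \<in> \<Omega> \<longrightarrow> poly_at f x > 0"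
    and y: "\<And>d. d0 \<le> d \<Longrightarrow> y d \<in> sdp_feasible p m g (moments \<mu>) d"
    and obj: "\<And>d. d0 \<le> d \<Longrightarrow> (LINT x:\<Omega>|\<mu>. poly_at f x) \<le> sdp_objective p f (y d)"
  shows "(\<lambda>d. \<Sum>i=1..p. y d i \<alpha>) \<longlonglongrightarrow> (LINT x:\<Omega>|\<mu>. monom_at \<alpha> x)"
proof (rule ccontr)
  let ?l = "LINT x:\<Omega>|\<mu>. monom_at \<alpha> x"
  assume "\<not> ?thesis"
  then obtain e where e: "0 < e" "\<not> (\<forall>\<^sub>F d in sequentially. dist (\<Sum>i=1..p. y d i \<alpha>) ?l < e)"
    unfolding tendsto_iff by blast
  then have "infinite {d. \<not> dist (\<Sum>i=1..p. y d i \<alpha>) ?l < e}"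
    by (simp add: cofinite_eq_sequentially[symmetric] eventually_cofinite)
  then obtain s where s: "strict_mono (s :: nat \<Rightarrow> nat)" "\<And>k. \<not> dist (\<Sum>i=1..p. y (s k) i \<alpha>) ?l < e"
    using infinite_enumerate[of "{d. \<not> dist (\<Sum>i=1..p. y d i \<alpha>) ?l < e}"] by auto
  have s_ge: "\<forall>\<^sub>F k in sequentially. N \<le> s k" for N
    using filterlim_subseq[OF s(1)] by (simp add: filterlim_at_top)
  have bnd: "\<exists>c. \<forall>\<^sub>F k in sequentially. \<bar>case t of (i, \<gamma>) \<Rightarrow> y (s k) i \<gamma>\<bar> \<le> c"
    if "t \<in> {1..p} \<times> (UNIV :: (nat ^ 'n) set)" for t
  proof -
    obtain i \<gamma> where t': "t = (i, \<gamma>)" by (cases t)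
    with that have i: "i \<in> {1..p}" by simp
    have "\<forall>\<^sub>F k in sequentially. \<bar>y (s k) i \<gamma>\<bar> \<le> (moments \<mu> (\<gamma> + \<gamma>) + moments \<mu> 0) / 2"
      using s_ge[of "max d0 (size_exp \<gamma>)"]
    proof eventually_elim
      case (elim k)
      then have "y (s k) \<in> sdp_feasible p m g (moments \<mu>) (s k)" by (intro y) simp
      from sdp_feasible_bound[OF this i, of \<gamma> 0] elim show ?case
        by (simp add: exps_upto_def)
    qed
    then show ?thesis unfolding t' prod.case by (rule exI)
  qed
  have "\<exists>r l. strict_mono (r :: nat \<Rightarrow> nat) \<and> (\<forall>t\<in>{1..p} \<times> (UNIV :: (nat ^ 'n) set).
      (\<lambda>k. case t of (i, \<gamma>) \<Rightarrow> y (s (r k)) i \<gamma>) \<longlonglongrightarrow> l t)"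
    by (rule pointwise_convergent_subsequence) (rule bnd)
  then obtain r l where r: "strict_mono (r :: nat \<Rightarrow> nat)"
    and l: "\<forall>t\<in>{1..p} \<times> (UNIV :: (nat ^ 'n) set).
      (\<lambda>k. case t of (i, \<gamma>) \<Rightarrow> y (s (r k)) i \<gamma>) \<longlonglongrightarrow> l t"
    by (elim exE conjE)
  define Y where "Y i \<gamma> = l (i, \<gamma>)" for i \<gamma>
  have lim: "(\<lambda>k. y (s (r k)) i \<gamma>) \<longlonglongrightarrow> Y i \<gamma>" if "i \<in> {1..p}" for i \<gamma>
    using bspec[OF l, of "(i, \<gamma>)"] that by (simp add: Y_def)
  have sr_ge: "\<forall>\<^sub>F k in sequentially. N \<le> s (r k)" for N
    using eventually_subseq[OF r s_ge] .
  have Y_feas: "Y \<in> sdp_feasible p m g (moments \<mu>) d" if d: "d0 \<le> d" for d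
  proof (rule sdp_feasible_limit)
    show "min_order p m g f \<le> d" using d d0 by simp
    show "\<forall>\<^sub>F k in sequentially. y (s (r k)) \<in> sdp_feasible p m g (moments \<mu>) d"
      using sr_ge[of d]
    proof eventually_elim
      case (elim k)
      then show ?case using y[of "s (r k)"] sdp_feasible_antimono[OF elim] d by fastforce
    qed
  qed (rule lim)
  have "(\<lambda>k. sdp_objective p f (y (s (r k)))) \<longlonglongrightarrow> sdp_objective p f Y"
    by (rule sdp_objective_tendsto[of p m g f d0]) (simp_all add: d0 lim)
  then have objY: "(LINT x:\<Omega>|\<mu>. poly_at f x) \<le> sdp_objective p f Y"
  proof (rule tendsto_lowerbound)
    show "\<forall>\<^sub>F k in sequentially. (LINT x:\<Omega>|\<mu>. poly_at f x) \<le> sdp_objective p f (y (s (r k)))"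
      using sr_ge[of d0] by eventually_elim (rule obj)
  qed simp
  have "(\<Sum>i=1..p. Y i \<alpha>) = ?l"
    by (rule sdp_limit_moments[OF d0 W \<Omega> f _ objY]) (rule Y_feas)
  moreover have "(\<lambda>k. \<Sum>i=1..p. y (s (r k)) i \<alpha>) \<longlonglongrightarrow> (\<Sum>i=1..p. Y i \<alpha>)"
    by (intro tendsto_sum lim)
  ultimately have "\<forall>\<^sub>F k in sequentially. dist (\<Sum>i=1..p. y (s (r k)) i \<alpha>) ?l < e"
    using e(1) by (simp add: tendsto_iff)
  then have "\<forall>\<^sub>F k :: nat in sequentially. False"
    by eventually_elim (use s(2) in blast)
  then show False by simp
qed

end

theorem theorem3p2:
  fixes B :: "(real ^ 'n::finite) set" and \<mu> :: "(real ^ 'n) measure"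
    and p :: nat and m :: "nat \<Rightarrow> nat"
    and g :: "nat \<Rightarrow> nat \<Rightarrow> 'n poly_ring" and f :: "'n poly_ring"
    and z :: "nat ^ 'n \<Rightarrow> real" and W :: "nat \<Rightarrow> (real ^ 'n) set" and \<Omega> :: "(real ^ 'n) set"
    and d0 :: nat and \<rho> :: "nat \<Rightarrow> ereal" and fstar :: ereal
  assumes "compact_box B"
    and "sets \<mu> = sets borel" and "finite_measure \<mu>" and "measure_support \<mu> = B"
    and "z = moments \<mu>"
    and "\<And>i. W i = semialg (m i) (g i)"
    and "\<Omega> = (\<Union>i\<in>{1..p}. W i)" and "\<Omega> \<subseteq> B"
    and "AE x in \<mu>. x \<in> \<Omega> \<longrightarrow> poly_at f x > 0"
    and "d0 = min_order p m g f"
    and "\<rho> = sdp_value p m g z f"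
    and "fstar = measure_lp_value p W \<mu> f"
  shows
    "(\<forall>d\<ge>d0. \<exists>y. sdp_optimal p m g z f d y) \<and>
     antimono_on {d0..} \<rho> \<and>
     \<rho> \<longlonglongrightarrow> fstar \<and>
     fstar = ereal (LINT x:\<Omega>|\<mu>. poly_at f x) \<and>
     (\<forall>y. (\<forall>d\<ge>d0. sdp_optimal p m g z f d (y d)) \<longrightarrow>
        (\<forall>\<alpha>. (\<lambda>d. \<Sum>i=1..p. y d i \<alpha>) \<longlonglongrightarrow> (LINT x:\<Omega>|\<mu>. monom_at \<alpha> x)) \<and>
        (\<lambda>d. \<Sum>i=1..p. y d i 0) \<longlonglongrightarrow> measure \<mu> \<Omega>)"
proof -
  interpret compact_measure B \<mu>
  proof (rule compact_measure.intro)
    show "compact B" using assms(1) by (auto simp: compact_box_def)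
    show "emeasure \<mu> (- B) = 0"
      using emeasure_outside_support[OF assms(2)] by (simp add: assms(4))
  qed fact+
  have W_borel: "W i \<in> sets borel" for i
    using semialg_closed[of "m i" "g i"] by (simp add: assms(6))
  then have \<Omega>_borel: "\<Omega> \<in> sets borel" unfolding assms(7) by auto
  let ?V = "LINT x:\<Omega>|\<mu>. poly_at f x"
  obtain D where D: "\<And>i. D i \<in> sets borel" "\<And>i. D i \<subseteq> W i" "disjoint_family D"
    "(\<Union>i\<in>{1..p}. D i) = \<Omega>"
    unfolding assms(7) by (rule disjoint_refinement[of W p, OF W_borel]) blast
  define y0 where "y0 i = moments_on (D i)" for i
  have y0: "y0 \<in> sdp_feasible p m g z d" for d
    unfolding y0_def assms(5)
    by (rule sdp_feasible_moments_on[OF D(1) _ D(3)]) (use D(2) in \<open>simp only: assms(6)\<close>)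
  have obj0: "sdp_objective p f y0 = ?V"
    unfolding y0_def sdp_objective_moments_on[OF D(1,3)] D(4) ..
  have exist: "\<exists>y. sdp_optimal p m g z f d y" if "d0 \<le> d" for d
  proof (rule sdp_optimal_exists)
    show "min_order p m g f \<le> d" using that assms(10) by simp
    show "sdp_feasible p m g z d \<noteq> {}" using y0[of d] by blast
  qed
  have anti: "antimono_on {d0..} \<rho>"
    unfolding assms(11) sdp_value_def
    by (intro monotone_onI SUP_subset_mono sdp_feasible_antimono order_refl)
  have fstar: "fstar = ereal ?V"
    unfolding assms(12)
    by (rule measure_lp_value_eq[OF compact_measure_axioms assms(6-9)])
  have tendsto: "(\<lambda>d. \<Sum>i=1..p. y d i \<alpha>) \<longlonglongrightarrow> (LINT x:\<Omega>|\<mu>. monom_at \<alpha> x)"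
    if y: "\<forall>d\<ge>d0. sdp_optimal p m g z f d (y d)" for y \<alpha>
  proof (rule sdp_moments_tendsto[OF assms(10,6,7,9)])
    show "y d \<in> sdp_feasible p m g (moments \<mu>) d" if "d0 \<le> d" for d
      using y that by (auto simp: sdp_optimal_def assms(5))
    show "?V \<le> sdp_objective p f (y d)" if "d0 \<le> d" for d
    proof -
      have "sdp_objective p f y0 \<le> sdp_objective p f (y d)"
        using y that y0[of d] unfolding sdp_optimal_def by blast
      then show ?thesis by (simp only: obj0)
    qed
  qed
  have \<rho>: "\<rho> \<longlonglongrightarrow> fstar"
  proof -
    have "\<forall>d\<in>{d0..}. \<exists>y. sdp_optimal p m g z f d y" using exist by blast
    then obtain y where "\<forall>d\<in>{d0..}. sdp_optimal p m g z f d (y d)" by (rule bchoice[THEN exE])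
    then have y: "\<forall>d\<ge>d0. sdp_optimal p m g z f d (y d)" by simp
    have obj: "sdp_objective p f y' = riesz (\<lambda>\<alpha>. \<Sum>i=1..p. y' i \<alpha>) f" for y'
      by (simp add: sdp_objective_def riesz_sum_seq)
    have "(\<lambda>d. sdp_objective p f (y d)) \<longlonglongrightarrow> riesz (moments_on \<Omega>) f"
      unfolding obj moments_on_def[abs_def] by (intro riesz_tendsto tendsto[OF y])
    then have "(\<lambda>d. ereal (sdp_objective p f (y d))) \<longlonglongrightarrow> fstar"
      by (simp add: fstar riesz_moments_on[OF \<Omega>_borel])
    moreover have "\<forall>\<^sub>F d in sequentially. ereal (sdp_objective p f (y d)) = \<rho> d"
      using eventually_ge_at_top[of d0]
    proof eventually_elim
      case (elim d)
      with y have "sdp_optimal p m g z f d (y d)" by blast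
      then show ?case unfolding assms(11) by (rule sdp_value_optimal[symmetric])
    qed
    ultimately show ?thesis by (rule Lim_transform_eventually)
  qed
  have "(LINT x:\<Omega>|\<mu>. monom_at 0 x) = measure \<mu> \<Omega>"
    using \<Omega>_borel by (simp add: set_lebesgue_integral_def sets_\<mu>)
  then have mass: "(\<lambda>d. \<Sum>i=1..p. y d i 0) \<longlonglongrightarrow> measure \<mu> \<Omega>"
    if "\<forall>d\<ge>d0. sdp_optimal p m g z f d (y d)" for y
    using tendsto[OF that, of 0] by simp
  show ?thesis
    by (intro conjI allI impI exist anti \<rho> fstar tendsto mass) blast+
qed

end
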